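(* Let $q$ be a prime of the form $3k+1$ and write $4q=L^2+27M^2$ with $L,M\in\mathbb{Z}$ and $L\equiv 1\pmod 3$. Let $p$ be a prime with $p\neq 2,3,q$ and $p\nmid M$. Then $$\sum_{k=1}^{[p/3]}\binom{3k}{k}\Big(\frac{L^2}{27q}\Big)^k\equiv\begin{cases}0\pmod p&\text{if }p^{\frac{q-1}{3}}\equiv 1\pmod q,\\[1mm]\frac{-3+L/(3M)}{2}\pmod p&\text{if }p^{\frac{q-1}{3}}\equiv\frac{-1-L/(3M)}{2}\pmod q,\\[1mm]\frac{-3-L/(3M)}{2}\pmod p&\text{if }p^{\frac{q-1}{3}}\equiv\frac{-1+L/(3M)}{2}\pmod q.\end{cases}$$
   Context: $[x]$ is the greatest integer not exceeding $x$. Congruences modulo a prime $\ell$ between rational numbers are taken in the ring of rational numbers whose denominator is not divisible by $\ell$. *)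

theory Defs
  imports "HOL-Number_Theory.Number_Theory"
begin

definition integral_at :: "nat \<Rightarrow> rat set" where
  "integral_at l = {x. \<not> int l dvd snd (quotient_of x)}"

text \<open>
  Congruence modulo the ideal generated by \<open>l\<close> in the ring \<open>integral_at l\<close>; both sides
  are required to belong to that ring.
\<close>

definition rat_cong :: "rat \<Rightarrow> rat \<Rightarrow> nat \<Rightarrow> bool" where
  "rat_cong x y l \<longleftrightarrow>
     x \<in> integral_at l \<and> y \<in> integral_at l \<and> (\<exists>z\<in>integral_at l. x - y = of_nat l * z)"

end

theory Submission
  imports Defs "HOL-Computational_Algebra.Polynomial"
begin

text \<open>
  Write \<open>n = [p/3]\<close>. For \<open>k \<le> n\<close> one has \<open>C(3k,k) \<equiv> (-27)^k C(n+k,2k)\<close> modulo \<open>p\<close>, so up to the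
  factor \<open>q^n\<close> the sum (with the term \<open>k = 0\<close> included) is \<open>\<Sum>k\<le>n. C(n+k,2k) (-L^2)^k q^(n-k)\<close>. For
  \<open>u = (L + 3 M \<surd>-3)/2\<close> and its conjugate \<open>v\<close>, which satisfy \<open>u + v = L\<close> and \<open>u v = q\<close>, this is
  \<open>(-1)^n (u^(2n+1) - v^(2n+1)) / (u - v)\<close>. Let \<open>\<omega>\<close> be the cube root of unity, \<open>s\<close> its residue
  modulo \<open>u\<close>, and \<open>\<chi>\<close> the cubic residue character of \<open>u\<close>. Its Jacobi sum is \<open>u\<close> itself: it has
  norm \<open>q\<close>, is \<open>-1\<close> modulo \<open>3\<close>, and is divisible by \<open>u\<close>. Raising the Gauss sum of \<open>\<chi>\<close> to the
  \<open>p\<close>-th power, once by the Frobenius congruence and once by the relation between its cube and the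
  Jacobi sum, gives \<open>\<chi>(p) (q u)^n \<equiv> 1\<close> or \<open>\<chi>(p)\<^sup>-\<^sup>1 (q u)^(n+1) \<equiv> q\<close> modulo \<open>p\<close>, according to
  \<open>p\<close> modulo \<open>3\<close>. In both cases the quotient above is
  \<open>q^n (\<chi>(p) u - \<chi>(p)\<^sup>-\<^sup>1 v) / (u - v)\<close> modulo \<open>p\<close>.
\<close>

section \<open>Eisenstein integers\<close>

text \<open>\<open>Eis a b\<close> stands for \<open>a + b \<omega>\<close> with \<open>\<omega>\<^sup>2 + \<omega> + 1 = 0\<close>.\<close>

datatype eis = Eis (ecoeff0: int) (ecoeff1: int)

instantiation eis :: comm_ring_1
begin

definition "0 = Eis 0 0"
definition "1 = Eis 1 0"
definition "x + y = Eis (ecoeff0 x + ecoeff0 y) (ecoeff1 x + ecoeff1 y)"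
definition "x - y = Eis (ecoeff0 x - ecoeff0 y) (ecoeff1 x - ecoeff1 y)"
definition "- x = Eis (- ecoeff0 x) (- ecoeff1 x)"
definition "x * y = Eis (ecoeff0 x * ecoeff0 y - ecoeff1 x * ecoeff1 y)
  (ecoeff0 x * ecoeff1 y + ecoeff1 x * ecoeff0 y - ecoeff1 x * ecoeff1 y)"

instance
  by standard
    (auto simp: zero_eis_def one_eis_def plus_eis_def minus_eis_def uminus_eis_def times_eis_def
      algebra_simps)

end

lemma ecoeff_simps [simp]:
  "ecoeff0 0 = 0" "ecoeff1 0 = 0" "ecoeff0 1 = 1" "ecoeff1 1 = 0"
  "ecoeff0 (x + y) = ecoeff0 x + ecoeff0 y" "ecoeff1 (x + y) = ecoeff1 x + ecoeff1 y"
  "ecoeff0 (x - y) = ecoeff0 x - ecoeff0 y" "ecoeff1 (x - y) = ecoeff1 x - ecoeff1 y"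
  "ecoeff0 (- x) = - ecoeff0 x" "ecoeff1 (- x) = - ecoeff1 x"
  "ecoeff0 (x * y) = ecoeff0 x * ecoeff0 y - ecoeff1 x * ecoeff1 y"
  "ecoeff1 (x * y) = ecoeff0 x * ecoeff1 y + ecoeff1 x * ecoeff0 y - ecoeff1 x * ecoeff1 y"
  by (simp_all add: zero_eis_def one_eis_def plus_eis_def minus_eis_def uminus_eis_def
      times_eis_def)

lemma ecoeff_of_nat [simp]: "ecoeff0 (of_nat n) = int n" "ecoeff1 (of_nat n) = 0"
  by (induction n) simp_all

lemma ecoeff_of_int [simp]: "ecoeff0 (of_int k) = k" "ecoeff1 (of_int k) = 0"
  by (cases k; simp)+

lemma ecoeff_sum:
  "ecoeff0 (sum f A) = (\<Sum>x\<in>A. ecoeff0 (f x))" "ecoeff1 (sum f A) = (\<Sum>x\<in>A. ecoeff1 (f x))"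
  by (induction A rule: infinite_finite_induct) simp_all

lemma eis_eqI: "ecoeff0 x = ecoeff0 y \<Longrightarrow> ecoeff1 x = ecoeff1 y \<Longrightarrow> x = y"
  by (simp add: eis.expand)

lemma eis_eq_iff: "x = y \<longleftrightarrow> ecoeff0 x = ecoeff0 y \<and> ecoeff1 x = ecoeff1 y"
  by (auto intro: eis_eqI)

lemma of_int_dvd_eis_iff: "of_int m dvd (x :: eis) \<longleftrightarrow> m dvd ecoeff0 x \<and> m dvd ecoeff1 x"
proof
  assume "m dvd ecoeff0 x \<and> m dvd ecoeff1 x"
  then obtain a b where "ecoeff0 x = m * a" "ecoeff1 x = m * b"
    by (auto elim!: dvdE)
  then have "x = of_int m * Eis a b"
    by (intro eis_eqI) simp_all
  then show "of_int m dvd x"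
    by simp
qed (auto elim!: dvdE)

definition eis_omega :: eis where
  "eis_omega = Eis 0 1"

text \<open>Complex conjugation, which sends \<open>eis_omega\<close> to its square
  \<open>-1 - eis_omega\<close>.\<close>

definition eis_cnj :: "eis \<Rightarrow> eis" where
  "eis_cnj x = Eis (ecoeff0 x - ecoeff1 x) (- ecoeff1 x)"

lemma ecoeff_omega [simp]: "ecoeff0 eis_omega = 0" "ecoeff1 eis_omega = 1"
  by (simp_all add: eis_omega_def)

lemma ecoeff_cnj [simp]:
  "ecoeff0 (eis_cnj x) = ecoeff0 x - ecoeff1 x" "ecoeff1 (eis_cnj x) = - ecoeff1 x"
  by (simp_all add: eis_cnj_def)

lemma eis_cnj_simps [simp]:
  "eis_cnj 0 = 0" "eis_cnj 1 = 1" "eis_cnj (x + y) = eis_cnj x + eis_cnj y"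
  "eis_cnj (x - y) = eis_cnj x - eis_cnj y" "eis_cnj (- x) = - eis_cnj x"
  "eis_cnj (x * y) = eis_cnj x * eis_cnj y" "eis_cnj (of_int k) = of_int k"
  "eis_cnj (of_nat n) = of_nat n" "eis_cnj (eis_cnj x) = x"
  by (rule eis_eqI; simp add: algebra_simps)+

lemma eis_cnj_power [simp]: "eis_cnj (x ^ n) = eis_cnj x ^ n"
  by (induction n) simp_all

lemma eis_cnj_sum: "eis_cnj (sum f A) = (\<Sum>x\<in>A. eis_cnj (f x))"
  by (induction A rule: infinite_finite_induct) simp_all

lemma eis_cnj_mono_dvd: "x dvd y \<Longrightarrow> eis_cnj x dvd eis_cnj y"
  by (metis dvdE dvdI eis_cnj_simps(6))

section \<open>Congruences in commutative rings\<close>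

text \<open>The inner binomial coefficients are multiples of \<open>p\<close>. The conclusion is a
  divisibility because the rings used later do not have characteristic \<open>p\<close>.\<close>

lemma frobenius_add:
  fixes x y :: "'a :: comm_ring_1"
  assumes "prime p"
  shows "of_nat p dvd (x + y) ^ p - (x ^ p + y ^ p)"
proof -
  have p: "p > 0" using assms by (simp add: prime_gt_0_nat)
  have "(x + y) ^ p = (\<Sum>k\<le>p. of_nat (p choose k) * x ^ k * y ^ (p - k))"
    by (rule binomial_ring)
  also have "{..p} = insert 0 (insert p {0<..<p})"
    using p by auto
  also have "(\<Sum>k\<in>\<dots>. of_nat (p choose k) * x ^ k * y ^ (p - k)) =
      (x ^ p + y ^ p) + (\<Sum>k\<in>{0<..<p}. of_nat (p choose k) * x ^ k * y ^ (p - k))"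
    using p by (simp add: algebra_simps)
  finally have "(x + y) ^ p - (x ^ p + y ^ p) =
      (\<Sum>k\<in>{0<..<p}. of_nat (p choose k) * x ^ k * y ^ (p - k))"
    by simp
  moreover have "of_nat p dvd (of_nat (p choose k) * x ^ k * y ^ (p - k) :: 'a)"
    if "k \<in> {0<..<p}" for k
  proof -
    have "p dvd p choose k"
      using that assms by (intro dvd_choose_prime) auto
    then have "(of_nat p :: 'a) dvd of_nat (p choose k)"
      by (metis dvdE dvd_triv_left of_nat_mult)
    then show ?thesis by (simp add: mult.assoc)
  qed
  ultimately show ?thesis
    by (metis (no_types, lifting) dvd_sum)
qed

lemma frobenius_sum:
  fixes f :: "'b \<Rightarrow> 'a :: comm_ring_1"
  assumes "prime p"
  shows "of_nat p dvd sum f A ^ p - (\<Sum>x\<in>A. f x ^ p)"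
proof (induction A rule: infinite_finite_induct)
  case (insert a A)
  have "of_nat p dvd ((f a + sum f A) ^ p - (f a ^ p + sum f A ^ p)) +
      (sum f A ^ p - (\<Sum>x\<in>A. f x ^ p))"
    by (intro dvd_add frobenius_add assms insert.IH)
  with insert.hyps show ?case by (simp add: algebra_simps)
qed (use assms prime_gt_0_nat in \<open>auto simp: zero_power\<close>)

text \<open>Congruence modulo the ideal generated by \<open>m\<close> and \<open>n\<close>. For
  \<open>n = X^q - 1\<close> and \<open>m = p\<close> it is equality in the group ring with
  coefficients reduced modulo \<open>p\<close>; \<open>m = 0\<close> gives exact equality in the
  group ring.\<close>

definition ideal_cong :: "'a :: comm_ring_1 \<Rightarrow> 'a \<Rightarrow> 'a \<Rightarrow> 'a \<Rightarrow> bool" where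
  "ideal_cong m n x y \<longleftrightarrow> (\<exists>u v. x - y = m * u + n * v)"

lemma ideal_cong_refl [simp]: "ideal_cong m n x x"
  unfolding ideal_cong_def by (rule exI[of _ 0], rule exI[of _ 0]) simp

lemma ideal_cong_sym: "ideal_cong m n x y \<Longrightarrow> ideal_cong m n y x"
  unfolding ideal_cong_def
  by (elim exE, rule_tac x = "- u" in exI, rule_tac x = "- v" in exI) (simp add: algebra_simps)

lemma ideal_cong_trans [trans]:
  assumes "ideal_cong m n x y" "ideal_cong m n y z"
  shows "ideal_cong m n x z"
proof -
  obtain u v u' v' where "x - y = m * u + n * v" "y - z = m * u' + n * v'"
    using assms unfolding ideal_cong_def by blast
  then have "x - z = m * (u + u') + n * (v + v')"
    by (simp add: algebra_simps)
  then show ?thesis unfolding ideal_cong_def by blast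
qed

lemma ideal_cong_add:
  assumes "ideal_cong m n x y" "ideal_cong m n x' y'"
  shows "ideal_cong m n (x + x') (y + y')"
proof -
  obtain u v u' v' where "x - y = m * u + n * v" "x' - y' = m * u' + n * v'"
    using assms unfolding ideal_cong_def by blast
  then have "(x + x') - (y + y') = m * (u + u') + n * (v + v')"
    by (simp add: algebra_simps)
  then show ?thesis unfolding ideal_cong_def by blast
qed

lemma ideal_cong_mult_left:
  assumes "ideal_cong m n x y"
  shows "ideal_cong m n (c * x) (c * y)"
proof -
  obtain u v where "x - y = m * u + n * v"
    using assms unfolding ideal_cong_def by blast
  then have "c * (x - y) = c * (m * u + n * v)"
    by simp
  then have "c * x - c * y = m * (c * u) + n * (c * v)"
    by (simp add: algebra_simps)
  then show ?thesis unfolding ideal_cong_def by blast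
qed

lemma ideal_cong_mult:
  assumes "ideal_cong m n x y" "ideal_cong m n x' y'"
  shows "ideal_cong m n (x * x') (y * y')"
proof -
  have "ideal_cong m n (x * x') (x * y')"
    by (rule ideal_cong_mult_left[OF assms(2)])
  also have "ideal_cong m n (x * y') (y * y')"
    using ideal_cong_mult_left[OF assms(1), of y'] by (simp add: mult.commute)
  finally show ?thesis .
qed

lemma ideal_cong_sum:
  "(\<And>i. i \<in> A \<Longrightarrow> ideal_cong m n (f i) (g i)) \<Longrightarrow> ideal_cong m n (sum f A) (sum g A)"
  by (induction A rule: infinite_finite_induct) (simp_all add: ideal_cong_add)

lemma ideal_cong_of_dvd: "m dvd x - y \<Longrightarrow> ideal_cong m n x y"
  unfolding ideal_cong_def by (elim dvdE, rule_tac x = k in exI, rule_tac x = 0 in exI) simp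

lemma ideal_cong_smult:
  "ideal_cong m n x y \<Longrightarrow> ideal_cong m n (smult c x) (smult c y)"
  using ideal_cong_mult_left[of m n x y "[:c:]"] by simp

section \<open>Group rings of cyclic groups\<close>

definition periodic :: "nat \<Rightarrow> (int \<Rightarrow> 'a) \<Rightarrow> bool" where
  "periodic q f \<longleftrightarrow> (\<forall>x. f (x mod int q) = f x)"

text \<open>As \<open>a\<close> is a unit modulo \<open>q\<close>, the map \<open>a * x + c\<close>
  permutes the residues, and a periodic \<open>f\<close> sees only the residue.\<close>

lemma sum_periodic_affine:
  fixes f :: "int \<Rightarrow> 'a :: comm_monoid_add"
  assumes "prime q" "\<not> int q dvd a" "periodic q f"
  shows "(\<Sum>x\<in>{0..<int q}. f (a * x + c)) = (\<Sum>x\<in>{0..<int q}. f x)"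
proof -
  have q: "int q > 0" using assms(1) by (simp add: prime_gt_0_nat)
  let ?g = "\<lambda>x. (a * x + c) mod int q"
  have cop: "coprime a (int q)"
    using assms by (metis coprime_commute prime_imp_coprime prime_nat_int_transfer)
  have inj: "inj_on ?g {0..<int q}"
  proof (rule inj_onI)
    fix x y assume xy: "x \<in> {0..<int q}" "y \<in> {0..<int q}" "?g x = ?g y"
    then have "[a * x + c = a * y + c] (mod int q)"
      by (simp add: cong_def)
    then have "[x = y] (mod int q)"
      using cong_mult_lcancel[OF cop] by (simp add: cong_add_rcancel)
    with xy show "x = y" by (simp add: cong_def)
  qed
  have "?g ` {0..<int q} = {0..<int q}"
    using q by (intro endo_inj_surj inj) auto
  then have "bij_betw ?g {0..<int q} {0..<int q}"
    using inj by (simp add: bij_betw_def)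
  from sum.reindex_bij_betw[OF this, of f] show ?thesis
    using assms(3) by (simp add: periodic_def)
qed

lemma periodic_mult_shift:
  fixes f h :: "int \<Rightarrow> 'a :: times"
  assumes "periodic q f" "periodic q h"
  shows "periodic q (\<lambda>x. f x * h (t - x))"
  using assms unfolding periodic_def by (metis mod_diff_right_eq mod_mod_trivial)

lemma smult_sum_right: "smult c (sum f A) = (\<Sum>x\<in>A. smult c (f x))"
  by (induction A rule: infinite_finite_induct) (simp_all add: smult_add_right)

text \<open>
  The ring of polynomials modulo \<open>X ^ q - 1\<close> is the group ring of \<open>\<int>/q\<int>\<close>, so the variable \<open>X\<close>
  takes the place of a primitive \<open>q\<close>-th root of unity in the Gauss sums below.
\<close>

definition grpring :: "nat \<Rightarrow> (int \<Rightarrow> 'a :: comm_ring_1) \<Rightarrow> 'a poly" where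
  "grpring q f = (\<Sum>x\<in>{0..<int q}. monom (f x) (nat x))"

text \<open>The coefficients of a product in the group ring. Functions live on all of
  \<open>int\<close>, with periodicity as a separate hypothesis, because \<open>t - x\<close> leaves
  the range \<open>0..<q\<close>.\<close>

definition convol :: "nat \<Rightarrow> (int \<Rightarrow> 'a) \<Rightarrow> (int \<Rightarrow> 'a) \<Rightarrow> int \<Rightarrow> 'a :: comm_ring_1" where
  "convol q f h t = (\<Sum>x\<in>{0..<int q}. f x * h (t - x))"

abbreviation grpcong :: "nat \<Rightarrow> nat \<Rightarrow> 'a :: comm_ring_1 poly \<Rightarrow> 'a poly \<Rightarrow> bool" where
  "grpcong q m \<equiv> ideal_cong (of_nat m) (monom 1 q - 1)"

lemma grpcong_monom: "grpcong q m (monom c k) (monom c (k mod q))"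
proof -
  have "(monom 1 q :: 'a poly) - 1 dvd monom 1 q ^ (k div q) - 1"
    using power_diff_1_eq[of "monom 1 q :: 'a poly"] by (simp add: dvd_def exI)
  then have "(monom 1 q :: 'a poly) - 1 dvd monom c (k mod q) * (monom 1 q ^ (k div q) - 1)"
    by simp
  also have "monom c (k mod q) * (monom 1 q ^ (k div q) - 1) = monom c k - monom c (k mod q)"
    by (simp add: monom_power right_diff_distrib mult_monom)
  finally show ?thesis
    unfolding ideal_cong_def by (elim dvdE, rule_tac x = 0 in exI, rule_tac x = ka in exI) simp
qed

text \<open>After expansion the exponents are reduced modulo \<open>q\<close>; replacing
  \<open>y\<close> by \<open>y - x\<close> in each inner sum then collects the terms with a common
  exponent.\<close>

lemma grpring_mult:
  assumes "prime q" "periodic q f" "periodic q h"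
  shows "grpcong q m (grpring q f * grpring q h) (grpring q (convol q f h))"
proof -
  have q: "int q > 0" "\<not> int q dvd 1"
    using assms(1) prime_gt_1_nat[of q] by auto
  let ?Z = "{0..<int q}"
  have "grpring q f * grpring q h = (\<Sum>x\<in>?Z. \<Sum>y\<in>?Z. monom (f x * h y) (nat x + nat y))"
    by (simp add: grpring_def sum_product mult_monom)
  also have "grpcong q m \<dots> (\<Sum>x\<in>?Z. \<Sum>y\<in>?Z. monom (f x * h y) ((nat x + nat y) mod q))"
    by (intro ideal_cong_sum grpcong_monom)
  also have "(\<Sum>x\<in>?Z. \<Sum>y\<in>?Z. monom (f x * h y) ((nat x + nat y) mod q)) =
      (\<Sum>x\<in>?Z. \<Sum>y\<in>?Z. monom (f x * h (y - x)) (nat (y mod int q)))"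
  proof (rule sum.cong[OF refl])
    fix x assume x: "x \<in> ?Z"
    let ?F = "\<lambda>y. monom (f x * h (y - x)) (nat (y mod int q))"
    have "periodic q ?F"
      using assms(3) unfolding periodic_def by (metis mod_diff_left_eq mod_mod_trivial)
    from sum_periodic_affine[OF assms(1) q(2) this, of x]
    have "(\<Sum>y\<in>?Z. ?F y) = (\<Sum>y\<in>?Z. ?F (y + x))"
      by simp
    also have "\<dots> = (\<Sum>y\<in>?Z. monom (f x * h y) ((nat x + nat y) mod q))"
      using x by (intro sum.cong) (auto simp: nat_mod_distrib nat_add_distrib add.commute)
    finally show "(\<Sum>y\<in>?Z. monom (f x * h y) ((nat x + nat y) mod q)) = (\<Sum>y\<in>?Z. ?F y)" ..
  qed
  also have "\<dots> = (\<Sum>y\<in>?Z. \<Sum>x\<in>?Z. monom (f x * h (y - x)) (nat (y mod int q)))"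
    by (rule sum.swap)
  also have "\<dots> = grpring q (convol q f h)"
    by (simp add: grpring_def convol_def monom_sum)
  finally show ?thesis .
qed

lemma coeff_grpring: "coeff (grpring q f) k = (if k < q then f (int k) else 0)"
proof -
  have "coeff (grpring q f) k = (\<Sum>x\<in>{0..<int q}. if x = int k then f x else 0)"
    unfolding grpring_def coeff_sum by (intro sum.cong) auto
  then show ?thesis by (simp add: sum.delta)
qed

lemma grpring_smult: "smult c (grpring q f) = grpring q (\<lambda>x. c * f x)"
  by (rule poly_eqI) (simp add: coeff_grpring)

text \<open>
  The sum of the coefficients in degrees congruent to \<open>1\<close> modulo \<open>q\<close> vanishes on multiples of
  \<open>X ^ q - 1\<close>.
\<close>

lemma grpring_cong_imp_dvd:
  assumes "q > 1" "grpcong q m (grpring q f) (grpring q h)"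
  shows "of_nat m dvd f 1 - h 1"
proof -
  obtain u v where uv: "grpring q f - grpring q h = of_nat m * u + (monom 1 q - 1) * v"
    using assms(2) unfolding ideal_cong_def by blast
  define N where "N = Suc (degree v)"
  let ?T = "\<lambda>w. \<Sum>i<N. coeff w (q * i + 1)"
  have T: "?T (grpring q f) = f 1" for f :: "int \<Rightarrow> 'a"
  proof -
    have "?T (grpring q f) = (\<Sum>i<N. if i = 0 then f 1 else 0)"
    proof (rule sum.cong[OF refl])
      fix i
      have "q * i + 1 < q \<longleftrightarrow> i = 0"
        using assms(1) by (cases i) auto
      then show "coeff (grpring q f) (q * i + 1) = (if i = 0 then f 1 else 0)"
        by (simp add: coeff_grpring)
    qed
    then show ?thesis by (simp add: N_def)
  qed
  have "?T ((monom 1 q - 1) * v) = 0"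
  proof -
    \<comment> \<open>Multiplication by \<open>X^q\<close> shifts the index \<open>i\<close> by one,
      so the sum telescopes. The choice of \<open>N\<close> puts the last remaining coefficient
      beyond the degree of \<open>v\<close>.\<close>
    let ?c = "\<lambda>i. if i = 0 then 0 else coeff v (q * (i - 1) + 1)"
    have "?T ((monom 1 q - 1) * v) = (\<Sum>i<N. ?c i - ?c (Suc i))"
    proof (rule sum.cong[OF refl])
      fix i
      show "coeff ((monom 1 q - 1) * v) (q * i + 1) = ?c i - ?c (Suc i)"
        using assms(1) by (cases i) (auto simp: left_diff_distrib coeff_monom_mult)
    qed
    also have "\<dots> = ?c 0 - ?c N"
      by (rule sum_lessThan_telescope')
    also have "\<dots> = - coeff v (q * degree v + 1)"
      by (simp add: N_def)
    also have "\<dots> = 0"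
      using assms(1) by (simp add: coeff_eq_0 le_imp_less_Suc)
    finally show ?thesis .
  qed
  moreover have "?T (of_nat m * u) = of_nat m * ?T u"
    by (simp add: of_nat_poly sum_distrib_left)
  ultimately have "?T (grpring q f - grpring q h) = of_nat m * ?T u"
    by (simp add: uv sum.distrib)
  then have "f 1 - h 1 = of_nat m * ?T u"
    using T[of f] T[of h] by (simp add: sum_subtractf)
  then show ?thesis by simp
qed

section \<open>Lucas sequences\<close>

definition lucas_odd :: "'a :: comm_ring_1 \<Rightarrow> 'a \<Rightarrow> nat \<Rightarrow> 'a" where
  "lucas_odd x w n = (\<Sum>k\<le>n. of_nat ((n + k) choose (2 * k)) * x ^ k * w ^ (n - k))"

text \<open>The companion of even index. In the setting of \<open>lucas_binet\<close> it is, up to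
  sign, the Lucas number of index \<open>2 * n\<close> divided by \<open>u + v\<close>; it serves to
  close the recurrence for \<open>lucas_odd\<close>.\<close>

definition lucas_even :: "'a :: comm_ring_1 \<Rightarrow> 'a \<Rightarrow> nat \<Rightarrow> 'a" where
  "lucas_even x w n = (\<Sum>k<n. of_nat ((n + k) choose (2 * k + 1)) * x ^ k * w ^ (n - 1 - k))"

text \<open>Pascal's rule splits each coefficient in two. In the part with lower index
  \<open>2 * k + 1\<close> the term \<open>k = n\<close> is zero, which leaves a common factor
  \<open>w\<close>.\<close>

lemma lucas_even_Suc: "lucas_even x w (Suc n) = w * lucas_even x w n + lucas_odd x w n"
proof -
  have "lucas_even x w (Suc n) =
      (\<Sum>k\<le>n. of_nat ((n + k) choose (2 * k + 1)) * x ^ k * w ^ (n - k)) + lucas_odd x w n"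
    by (simp add: lucas_even_def lucas_odd_def lessThan_Suc_atMost algebra_simps
        flip: sum.distrib)
  also have "(\<Sum>k\<le>n. of_nat ((n + k) choose (2 * k + 1)) * x ^ k * w ^ (n - k)) =
      (\<Sum>k<n. of_nat ((n + k) choose (2 * k + 1)) * x ^ k * w ^ (n - k))"
    by (simp add: binomial_eq_0 flip: lessThan_Suc_atMost)
  also have "\<dots> = w * lucas_even x w n"
    unfolding lucas_even_def sum_distrib_left
  proof (rule sum.cong[OF refl])
    fix k assume "k \<in> {..<n}"
    then have "n - k = Suc (n - 1 - k)"
      by auto
    then show "of_nat ((n + k) choose (2 * k + 1)) * x ^ k * w ^ (n - k) =
        w * (of_nat ((n + k) choose (2 * k + 1)) * x ^ k * w ^ (n - 1 - k))"
      by (simp add: mult_ac)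
  qed
  finally show ?thesis .
qed

text \<open>Again Pascal's rule, after the term \<open>k = 0\<close> is split off and the index
  shifted. The split-off power of \<open>w\<close> returns as the first term of
  \<open>w * lucas_odd x w n\<close>.\<close>

lemma lucas_odd_Suc: "lucas_odd x w (Suc n) = w * lucas_odd x w n + x * lucas_even x w (Suc n)"
proof -
  have "lucas_odd x w (Suc n) =
      w ^ Suc n + (\<Sum>k\<le>n. of_nat ((n + 2 + k) choose (2 * k + 2)) * x ^ (k + 1) * w ^ (n - k))"
    unfolding lucas_odd_def sum.atMost_Suc_shift by simp
  also have "(\<Sum>k\<le>n. of_nat ((n + 2 + k) choose (2 * k + 2)) * x ^ (k + 1) * w ^ (n - k)) =
      (\<Sum>k\<le>n. of_nat ((n + 1 + k) choose (2 * k + 2)) * x ^ (k + 1) * w ^ (n - k)) +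
      x * lucas_even x w (Suc n)"
    by (simp add: lucas_even_def lessThan_Suc_atMost sum_distrib_left algebra_simps
        flip: sum.distrib)
  also have "(\<Sum>k\<le>n. of_nat ((n + 1 + k) choose (2 * k + 2)) * x ^ (k + 1) * w ^ (n - k)) =
      (\<Sum>k<n. of_nat ((n + 1 + k) choose (2 * k + 2)) * x ^ (k + 1) * w ^ (n - k))"
    by (simp add: binomial_eq_0 flip: lessThan_Suc_atMost)
  also have "\<dots> = (\<Sum>k<n. w * (of_nat ((n + Suc k) choose (2 * Suc k)) * x ^ Suc k * w ^ (n - Suc k)))"
  proof (rule sum.cong[OF refl])
    fix k assume "k \<in> {..<n}"
    then have "n - k = Suc (n - Suc k)"
      by auto
    then show "of_nat ((n + 1 + k) choose (2 * k + 2)) * x ^ (k + 1) * w ^ (n - k) =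
        w * (of_nat ((n + Suc k) choose (2 * Suc k)) * x ^ Suc k * w ^ (n - Suc k))"
      by (simp add: mult_ac)
  qed
  also have "w ^ Suc n + (\<dots> + x * lucas_even x w (Suc n)) =
      w * lucas_odd x w n + x * lucas_even x w (Suc n)"
    unfolding lucas_odd_def
    by (subst sum.atMost_shift) (simp add: sum_distrib_left algebra_simps)
  finally show ?thesis .
qed

text \<open>Both formulas follow by a joint induction from the two recurrences, and are multiplied
  out because a general ring has no division. The even one comes first in the step, since
  \<open>lucas_odd_Suc\<close> refers to \<open>lucas_even\<close> at \<open>Suc n\<close>.\<close>

lemma lucas_binet:
  fixes u v :: "'a :: comm_ring_1"
  defines "x \<equiv> - ((u + v) ^ 2)" and "w \<equiv> u * v"
  shows "(u - v) * lucas_odd x w n = (- 1) ^ n * (u ^ (2 * n + 1) - v ^ (2 * n + 1))"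
    and "(u - v) * (u + v) * lucas_even x w n = - ((- 1) ^ n * (u ^ (2 * n) - v ^ (2 * n)))"
proof (induction n)
  case (Suc n)
  have "(u - v) * (u + v) * lucas_even x w (Suc n) =
      w * ((u - v) * (u + v) * lucas_even x w n) + (u + v) * ((u - v) * lucas_odd x w n)"
    by (simp add: lucas_even_Suc algebra_simps)
  also have "\<dots> = (- 1) ^ n * (u ^ (2 * n + 2) - v ^ (2 * n + 2))"
    unfolding Suc.IH by (simp add: w_def algebra_simps)
  finally have even: "(u - v) * (u + v) * lucas_even x w (Suc n) =
      (- 1) ^ n * (u ^ (2 * n + 2) - v ^ (2 * n + 2))" .
  then show "(u - v) * (u + v) * lucas_even x w (Suc n) =
      - ((- 1) ^ Suc n * (u ^ (2 * Suc n) - v ^ (2 * Suc n)))"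
    by simp
  have "(u - v) * lucas_odd x w (Suc n) =
      w * ((u - v) * lucas_odd x w n) - (u + v) * ((u - v) * (u + v) * lucas_even x w (Suc n))"
    by (simp add: lucas_odd_Suc x_def algebra_simps power2_eq_square)
  also have "\<dots> = (- 1) ^ Suc n * (u ^ (2 * Suc n + 1) - v ^ (2 * Suc n + 1))"
    unfolding Suc.IH even by (simp add: w_def algebra_simps)
  finally show "(u - v) * lucas_odd x w (Suc n) =
      (- 1) ^ Suc n * (u ^ (2 * Suc n + 1) - v ^ (2 * Suc n + 1))" .
qed (simp_all add: lucas_odd_def lucas_even_def)

section \<open>Cubic Gauss and Jacobi sums\<close>

text \<open>A primitive root has order \<open>q - 1\<close>, which cannot divide the smaller
  positive \<open>m\<close>. Such an \<open>a\<close> forces character sums and power sums to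
  vanish.\<close>

lemma exists_power_not_cong_1:
  assumes "prime q" "0 < m" "m < q - 1"
  shows "\<exists>a :: int. \<not> int q dvd a \<and> \<not> [a ^ m = 1] (mod int q)"
proof -
  obtain g where g: "residue_primroot q g"
    using assms prime_primitive_root_exists[of q] prime_gt_1_nat[of q] by auto
  then have "coprime q g" "ord q g = q - 1"
    using assms by (auto simp: residue_primroot_def totient_prime)
  moreover have "\<not> [g ^ m = 1] (mod q)"
    using assms \<open>ord q g = q - 1\<close> ord_divides[of g m q] dvd_imp_le[of "q - 1" m] by auto
  then have "\<not> [int g ^ m = 1] (mod int q)"
    by (metis cong_int_iff of_nat_1 of_nat_power)
  moreover have "\<not> int q dvd int g"
    using \<open>coprime q g\<close> assms(1) by (metis coprime_absorb_left int_dvd_int_iff not_prime_unit)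
  ultimately show ?thesis by blast
qed

section \<open>Cube roots of unity and the cubic residue character modulo \<open>q\<close>\<close>

definition cubic_values :: "eis set" where
  "cubic_values = {0, 1, eis_omega, eis_cnj eis_omega}"

lemma cubic_values_mult: "x \<in> cubic_values \<Longrightarrow> y \<in> cubic_values \<Longrightarrow> x * y \<in> cubic_values"
  unfolding cubic_values_def by (elim insertE emptyE; simp add: eis_eq_iff)

lemma cubic_values_square: "x \<in> cubic_values \<Longrightarrow> x ^ 2 = eis_cnj x"
  unfolding cubic_values_def by (elim insertE emptyE; simp add: eis_eq_iff power2_eq_square)

lemma cubic_values_mult_cnj: "x \<in> cubic_values \<Longrightarrow> x \<noteq> 0 \<Longrightarrow> x * eis_cnj x = 1"
  unfolding cubic_values_def by (elim insertE emptyE; simp add: eis_eq_iff)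

lemma cubic_values_cube: "x \<in> cubic_values \<Longrightarrow> x \<noteq> 0 \<Longrightarrow> x ^ 3 = 1"
  using cubic_values_mult_cnj[of x] cubic_values_square[of x]
  by (simp add: power3_eq_cube power2_eq_square mult.assoc mult.commute)

text \<open>The integer \<open>s\<close> is a primitive cube root of unity modulo \<open>q\<close>;
  choosing it amounts to choosing a prime of the Eisenstein integers above \<open>q\<close>.\<close>

locale cubic_residue =
  fixes q :: nat and s :: int
  assumes prime_q: "prime q" and q_mod_3: "[q = 1] (mod 3)" and s: "int q dvd s ^ 2 + s + 1"
begin

text \<open>The cube root of unity whose image under \<open>eis_omega\<close> to \<open>s\<close> is
  the power of \<open>x\<close>. The last branch stands for the residue \<open>-1 - s\<close>, the
  only one left by \<open>red_chi\<close>.\<close>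

definition chi :: "int \<Rightarrow> eis" where
  "chi x = (if int q dvd x then 0
     else if [x ^ ((q - 1) div 3) = 1] (mod int q) then 1
     else if [x ^ ((q - 1) div 3) = s] (mod int q) then eis_omega
     else eis_cnj eis_omega)"

text \<open>The ring homomorphism to the integers modulo \<open>q\<close> that sends
  \<open>eis_omega\<close> to \<open>s\<close>, given by an integer representative and hence
  multiplicative only modulo \<open>q\<close>.\<close>

definition red :: "eis \<Rightarrow> int" where
  "red z = ecoeff0 z + ecoeff1 z * s"

lemma q_gt_3: "q > 3"
proof -
  have "q \<noteq> 2" "q \<noteq> 3"
    using q_mod_3 by (auto simp: cong_def)
  then show ?thesis
    using prime_q prime_ge_2_nat[of q] by linarith
qed

lemma exponent: "3 * ((q - 1) div 3) = q - 1"
proof -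
  have "q mod 3 = 1"
    using q_mod_3 by (simp add: cong_def)
  then show ?thesis by presburger
qed

lemma prime_int_q: "prime (int q)"
  using prime_q by simp

lemma red_mult: "[red (x * y) = red x * red y] (mod int q)"
proof -
  have "red x * red y - red (x * y) = ecoeff1 x * ecoeff1 y * (s ^ 2 + s + 1)"
    by (simp add: red_def algebra_simps power2_eq_square)
  then have "int q dvd red x * red y - red (x * y)"
    using s by simp
  then show ?thesis
    by (simp add: cong_iff_dvd_diff dvd_diff_commute)
qed

lemma red_inj:
  assumes "x \<in> cubic_values" "y \<in> cubic_values" "[red x = red y] (mod int q)"
  shows "x = y"
proof -
  \<comment> \<open>For each difference \<open>k\<close> of two candidate residues, a suitable
    \<open>m\<close> makes \<open>k * m\<close> equal to \<open>1\<close>, \<open>-1\<close> or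
    \<open>-3\<close> up to a multiple of \<open>s^2 + s + 1\<close>; as \<open>q > 3\<close>, none
    of these is divisible by \<open>q\<close>.\<close>
  have not_dvd: "\<not> int q dvd k" if "k * m - j * (s ^ 2 + s + 1) \<in> {1, - 1, - 3}" for k m j
  proof
    assume "int q dvd k"
    then have "int q dvd k * m - j * (s ^ 2 + s + 1)"
      using s by simp
    with that have "int q dvd 1 \<or> int q dvd 3"
      by auto
    then show False
      using q_gt_3 zdvd_not_zless[of 1 "int q"] zdvd_not_zless[of 3 "int q"] by auto
  qed
  have "\<not> [0 = 1] (mod int q)" "\<not> [0 = s] (mod int q)" "\<not> [0 = - 1 - s] (mod int q)"
    "\<not> [1 = s] (mod int q)" "\<not> [1 = - 1 - s] (mod int q)" "\<not> [s = - 1 - s] (mod int q)"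
    unfolding cong_iff_dvd_diff
    using not_dvd[of "0 - 1" "- 1" 0] not_dvd[of "0 - s" "- s - 1" 1]
      not_dvd[of "0 - (- 1 - s)" s 1] not_dvd[of "1 - s" "- s - 2" 1]
      not_dvd[of "1 - (- 1 - s)" "s - 1" 1] not_dvd[of "s - (- 1 - s)" "2 * s + 1" 4]
    by (simp_all add: algebra_simps power2_eq_square)
  then show ?thesis
    using assms unfolding cubic_values_def
    by (elim insertE emptyE; simp add: red_def cong_sym_eq)
qed

lemma chi_in: "chi x \<in> cubic_values"
  by (simp add: chi_def cubic_values_def)

lemma chi_eq_0_iff: "chi x = 0 \<longleftrightarrow> int q dvd x"
  by (simp add: chi_def eis_eq_iff)

text \<open>By Fermat the power \<open>t\<close> of \<open>x\<close> satisfies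
  \<open>t^3 = 1\<close> modulo \<open>q\<close>, and there \<open>t^3 - 1\<close> factors as
  \<open>(t - 1) * (t - s) * (t + 1 + s)\<close>.\<close>

lemma red_chi: "[red (chi x) = x ^ ((q - 1) div 3)] (mod int q)"
proof (cases "int q dvd x")
  case True
  moreover have "(q - 1) div 3 > 0"
    using exponent q_gt_3 by linarith
  ultimately have "int q dvd x ^ ((q - 1) div 3)"
    by (meson dvd_power_same dvd_trans dvd_power)
  then show ?thesis
    using True by (simp add: chi_def red_def cong_iff_dvd_diff)
next
  case False
  define t where "t = x ^ ((q - 1) div 3)"
  have "[x ^ (q - 1) = 1] (mod int q)"
  proof -
    have "\<not> q dvd nat (x mod int q)"
    proof -
      have "int (nat (x mod int q)) = x mod int q"
        using q_gt_3 by simp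
      then have "\<not> int q dvd int (nat (x mod int q))"
        using False by (simp add: dvd_mod_iff)
      then show ?thesis
        unfolding int_dvd_int_iff .
    qed
    from fermat_theorem[OF prime_q this]
    have "[int (nat (x mod int q)) ^ (q - 1) = 1] (mod int q)"
      by (metis cong_int_iff of_nat_1 of_nat_power)
    then show ?thesis
      using q_gt_3 by (simp add: cong_def power_mod)
  qed
  then have "[t ^ 3 = 1] (mod int q)"
    by (simp only: t_def exponent mult.commute[of _ 3] flip: power_mult)
  moreover have "(t - 1) * ((t - s) * (t + 1 + s)) = t ^ 3 - 1 - (t - 1) * (s ^ 2 + s + 1)"
    by (simp add: algebra_simps power2_eq_square power3_eq_cube)
  ultimately have "int q dvd (t - 1) * ((t - s) * (t + 1 + s))"
    using s by (simp add: cong_iff_dvd_diff dvd_diff)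
  then have "int q dvd t - 1 \<or> int q dvd t - s \<or> int q dvd t + 1 + s"
    using prime_int_q by (simp add: prime_dvd_mult_iff)
  then show ?thesis
    using False
    by (auto simp: chi_def red_def t_def cong_iff_dvd_diff algebra_simps dvd_diff_commute)
qed

lemma chi_eqI: "z \<in> cubic_values \<Longrightarrow> [red z = x ^ ((q - 1) div 3)] (mod int q) \<Longrightarrow> chi x = z"
  by (meson chi_in cong_sym cong_trans red_chi red_inj)

lemma chi_mult: "chi (x * y) = chi x * chi y"
proof (rule chi_eqI)
  have "[red (chi x * chi y) = red (chi x) * red (chi y)] (mod int q)"
    by (rule red_mult)
  also have "[red (chi x) * red (chi y) = x ^ ((q - 1) div 3) * y ^ ((q - 1) div 3)] (mod int q)"
    by (intro cong_mult red_chi)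
  finally show "[red (chi x * chi y) = (x * y) ^ ((q - 1) div 3)] (mod int q)"
    by (simp add: power_mult_distrib)
qed (simp add: cubic_values_mult chi_in)

lemma periodic_chi: "periodic q chi"
  unfolding periodic_def
proof
  fix x
  show "chi (x mod int q) = chi x"
    by (rule chi_eqI[OF chi_in]) (metis cong_mod_left cong_pow cong_refl cong_sym cong_trans red_chi)
qed

lemma chi_1: "chi 1 = 1"
  using q_gt_3 by (simp add: chi_def)

text \<open>\<open>-1\<close> is its own cube, and every cube has character
  \<open>1\<close>.\<close>

lemma chi_minus_1: "chi (- 1) = 1"
proof -
  have "chi (- 1) \<noteq> 0"
    using q_gt_3 by (simp add: chi_eq_0_iff)
  then have "chi (- 1) ^ 3 = 1"
    by (rule cubic_values_cube[OF chi_in])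
  moreover have "chi (- 1) ^ 3 = chi ((- 1) * (- 1) * (- 1))"
    by (simp only: chi_mult power3_eq_cube)
  ultimately show ?thesis by simp
qed

text \<open>Multiplying the argument by a cubic nonresidue \<open>a\<close> permutes the terms but
  scales the sum by \<open>chi a\<close>, which is not \<open>1\<close>.\<close>

lemma sum_chi: "(\<Sum>x\<in>{0..<int q}. chi x) = 0"
proof -
  have "0 < (q - 1) div 3" "(q - 1) div 3 < q - 1"
    using exponent q_gt_3 by linarith+
  then obtain a where a: "\<not> int q dvd a" "\<not> [a ^ ((q - 1) div 3) = 1] (mod int q)"
    using exists_power_not_cong_1[OF prime_q] by blast
  let ?S = "\<Sum>x\<in>{0..<int q}. chi x"
  have "chi a * ?S = (\<Sum>x\<in>{0..<int q}. chi (a * x + 0))"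
    by (simp add: chi_mult sum_distrib_left)
  also have "\<dots> = ?S"
    by (rule sum_periodic_affine[OF prime_q a(1) periodic_chi])
  finally have *: "chi a * ?S = ?S" .
  have "chi a \<in> {eis_omega, eis_cnj eis_omega}"
    using a by (simp add: chi_def)
  with * show ?thesis
    by (auto simp: eis_eq_iff intro!: eis_eqI)
qed

abbreviation "chibar x \<equiv> eis_cnj (chi x)"

lemma sum_chibar: "(\<Sum>x\<in>{0..<int q}. chibar x) = 0"
  using arg_cong[OF sum_chi, of eis_cnj] by (simp add: eis_cnj_sum)

lemma periodic_chibar: "periodic q chibar"
  using periodic_chi by (simp add: periodic_def)

section \<open>The Jacobi sum and convolutions of the character\<close>

definition jacobi :: eis where
  "jacobi = (\<Sum>x\<in>{0..<int q}. chi x * chi (1 - x))"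

text \<open>Substituting \<open>t * x\<close> for \<open>x\<close> pulls out
  \<open>chi t ^ 2\<close>, the conjugate of \<open>chi t\<close>. If \<open>q\<close> divides
  \<open>t\<close>, the convolution becomes the vanishing sum of \<open>chibar\<close>.\<close>

lemma convol_chi_chi: "convol q chi chi t = jacobi * chibar t"
proof (cases "int q dvd t")
  case True
  have "chi x * chi (t - x) = chibar x" for x
  proof -
    have "chi (t - x) = chi ((t - x) mod int q)"
      using periodic_chi by (simp add: periodic_def)
    also have "(t - x) mod int q = (- x) mod int q"
      using True by (metis diff_0 dvd_eq_mod_eq_0 mod_diff_left_eq)
    also have "chi \<dots> = chi (- 1 * x)"
      using periodic_chi by (simp add: periodic_def)
    also have "\<dots> = chi x"
      by (simp only: chi_mult chi_minus_1 mult_1)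
    finally show ?thesis
      using cubic_values_square[OF chi_in] by (simp add: power2_eq_square)
  qed
  then show ?thesis
    using True sum_chibar by (simp add: convol_def chi_def)
next
  case False
  have "convol q chi chi t = (\<Sum>x\<in>{0..<int q}. chi (t * x + 0) * chi (t - (t * x + 0)))"
    unfolding convol_def
    by (rule sum_periodic_affine[symmetric, OF prime_q False])
      (rule periodic_mult_shift[OF periodic_chi periodic_chi])
  also have "\<dots> = (\<Sum>x\<in>{0..<int q}. chi t ^ 2 * (chi x * chi (1 - x)))"
  proof (rule sum.cong[OF refl])
    fix x
    have "t - (t * x + 0) = t * (1 - x)"
      by (simp add: algebra_simps)
    then show "chi (t * x + 0) * chi (t - (t * x + 0)) = chi t ^ 2 * (chi x * chi (1 - x))"
      by (simp add: chi_mult power2_eq_square mult_ac)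
  qed
  also have "\<dots> = jacobi * chibar t"
    by (simp add: jacobi_def cubic_values_square[OF chi_in] mult.commute flip: sum_distrib_left)
  finally show ?thesis .
qed

text \<open>The value at \<open>0\<close> counts the nonzero residues, and scaling shows that all
  other values agree. Their common value follows because the total over all \<open>t\<close> is a
  product of vanishing character sums.\<close>

lemma convol_chi_chibar: "convol q chi chibar t = (if int q dvd t then of_nat q - 1 else - 1)"
proof -
  let ?Z = "{0..<int q}" and ?h = "convol q chi chibar"
  have periodic_h: "periodic q ?h"
    unfolding periodic_def convol_def
  proof (intro allI sum.cong refl)
    fix t x
    show "chi x * chibar (t mod int q - x) = chi x * chibar (t - x)"
      using periodic_chi unfolding periodic_def by (metis mod_diff_left_eq)
  qed
  have h0: "?h t = of_nat q - 1" if "int q dvd t" for t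
  proof -
    have "?h t = ?h 0"
      using that periodic_h unfolding periodic_def by (metis dvd_eq_mod_eq_0)
    also have "\<dots> = (\<Sum>x\<in>?Z. 1 - (if x = 0 then 1 else 0))"
      unfolding convol_def
    proof (rule sum.cong[OF refl])
      fix x assume x: "x \<in> ?Z"
      have "chi (0 - x) = chi (- 1 * x)"
        by simp
      also have "\<dots> = chi x"
        by (simp only: chi_mult chi_minus_1 mult_1)
      finally have "chi (0 - x) = chi x" .
      moreover have "chi x = 0 \<longleftrightarrow> x = 0"
        using x by (auto simp: chi_eq_0_iff dvd_eq_mod_eq_0)
      ultimately show "chi x * chibar (0 - x) = 1 - (if x = 0 then 1 else 0)"
        using cubic_values_mult_cnj[OF chi_in, of x] by auto
    qed
    also have "\<dots> = of_nat q - 1"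
      using q_gt_3 by (simp add: sum_subtractf sum.delta)
    finally show ?thesis .
  qed
  have h1: "?h t = ?h 1" if "\<not> int q dvd t" for t
  proof -
    have "?h t = (\<Sum>x\<in>?Z. chi (t * x + 0) * chibar (t - (t * x + 0)))"
      unfolding convol_def
      by (rule sum_periodic_affine[symmetric, OF prime_q that])
        (rule periodic_mult_shift[OF periodic_chi periodic_chibar])
    also have "\<dots> = (\<Sum>x\<in>?Z. chi x * chibar (1 - x))"
    proof (rule sum.cong[OF refl])
      fix x
      have "t - (t * x + 0) = t * (1 - x)"
        by (simp add: algebra_simps)
      then have "chi (t * x + 0) * chibar (t - (t * x + 0)) =
          (chi t * chibar t) * (chi x * chibar (1 - x))"
        by (simp add: chi_mult mult_ac)
      then show "chi (t * x + 0) * chibar (t - (t * x + 0)) = chi x * chibar (1 - x)"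
        using that by (simp add: cubic_values_mult_cnj[OF chi_in] chi_eq_0_iff)
    qed
    finally show ?thesis by (simp add: convol_def)
  qed
  have "(\<Sum>t\<in>?Z. ?h t) = (\<Sum>x\<in>?Z. \<Sum>t\<in>?Z. chi x * chibar (t - x))"
    unfolding convol_def by (rule sum.swap)
  also have "\<dots> = (\<Sum>x\<in>?Z. chi x * (\<Sum>t\<in>?Z. chibar (1 * t + (- x))))"
    by (simp add: sum_distrib_left)
  also have "\<dots> = 0"
    using q_gt_3 by (subst sum_periodic_affine[OF prime_q _ periodic_chibar]) (simp_all add: sum_chibar)
  finally have "0 = (\<Sum>t\<in>?Z. ?h t)" ..
  also have "\<dots> = (\<Sum>t\<in>?Z. ?h 1 + (if t = 0 then of_nat q - 1 - ?h 1 else 0))"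
  proof (rule sum.cong[OF refl])
    fix t assume "t \<in> ?Z"
    then have "int q dvd t \<longleftrightarrow> t = 0"
      by (auto simp: dvd_eq_mod_eq_0)
    then show "?h t = ?h 1 + (if t = 0 then of_nat q - 1 - ?h 1 else 0)"
      using h0 h1 by auto
  qed
  also have "\<dots> = of_nat q * ?h 1 + (of_nat q - 1 - ?h 1)"
    using q_gt_3 by (simp add: sum.distrib sum.delta)
  also have "\<dots> = of_nat (q - 1) * (?h 1 + 1)"
    using q_gt_3 by (simp add: of_nat_diff algebra_simps)
  finally have "of_nat (q - 1) * (?h 1 + 1) = 0" ..
  then have "ecoeff0 (of_nat (q - 1) * (?h 1 + 1)) = 0" "ecoeff1 (of_nat (q - 1) * (?h 1 + 1)) = 0"
    by simp_all
  then have "?h 1 = - 1"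
    using q_gt_3 by (intro eis_eqI) (auto simp del: of_nat_diff)
  with h0 h1 show ?thesis by simp
qed

section \<open>Gauss sums in the group ring and their powers\<close>

abbreviation gauss :: "eis poly" where
  "gauss \<equiv> grpring q chi"

abbreviation gaussbar :: "eis poly" where
  "gaussbar \<equiv> grpring q chibar"

lemma gauss_square: "grpcong q m (gauss * gauss) (smult jacobi gaussbar)"
  using grpring_mult[OF prime_q periodic_chi periodic_chi, of m]
  by (simp add: convol_chi_chi[abs_def] grpring_smult)

lemma gaussbar_square: "grpcong q m (gaussbar * gaussbar) (smult (eis_cnj jacobi) gauss)"
proof -
  have "convol q chibar chibar t = eis_cnj (convol q chi chi t)" for t
    by (simp add: convol_def eis_cnj_sum)
  then have "convol q chibar chibar = (\<lambda>t. eis_cnj jacobi * chi t)"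
    by (simp add: fun_eq_iff convol_chi_chi)
  then show ?thesis
    using grpring_mult[OF prime_q periodic_chibar periodic_chibar, of m]
    by (simp add: grpring_smult)
qed

lemma gauss_gaussbar:
  "grpcong q m (gauss * gaussbar) (grpring q (\<lambda>t. if int q dvd t then of_nat q - 1 else - 1))"
  using grpring_mult[OF prime_q periodic_chi periodic_chibar, of m]
  by (simp add: convol_chi_chibar[abs_def])

text \<open>In the group ring \<open>gauss * gaussbar\<close> is \<open>q\<close> minus the sum of
  all powers of \<open>X\<close>, not \<open>q\<close> itself. A further factor \<open>gauss\<close>
  annihilates that sum, since the values of \<open>chi\<close> add up to zero.\<close>

lemma gauss_gauss_gaussbar:
  "grpcong q m (gauss * (gauss * gaussbar)) (smult (of_nat q) gauss)"
proof -
  define h :: "int \<Rightarrow> eis" where "h = (\<lambda>t. if int q dvd t then of_nat q - 1 else - 1)"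
  have "periodic q h"
    by (simp add: periodic_def h_def dvd_mod_iff)
  have "convol q chi h t = of_nat q * chi t" for t
  proof -
    have "chi x * h (t - x) = (if x = t mod int q then of_nat q * chi t else 0) - chi x"
      if "x \<in> {0..<int q}" for x
    proof -
      have "int q dvd t - x \<longleftrightarrow> x = t mod int q"
        using that by (auto simp: mod_eq_dvd_iff[symmetric])
      moreover have "chi (t mod int q) = chi t"
        using periodic_chi by (simp add: periodic_def)
      ultimately show ?thesis
        by (auto simp: h_def algebra_simps)
    qed
    then have "convol q chi h t = (\<Sum>x\<in>{0..<int q}. if x = t mod int q then of_nat q * chi t else 0)"
      using sum_chi by (simp add: convol_def sum_subtractf)
    then show ?thesis
      using q_gt_3 by (simp add: sum.delta)
  qed
  then have "convol q chi h = (\<lambda>t. of_nat q * chi t)"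
    by (simp add: fun_eq_iff)
  then have *: "grpcong q m (gauss * grpring q h) (smult (of_nat q) gauss)"
    using grpring_mult[OF prime_q periodic_chi \<open>periodic q h\<close>, of m]
    by (simp add: grpring_smult)
  show ?thesis
    using ideal_cong_mult_left[OF gauss_gaussbar, of m gauss] * ideal_cong_trans
    unfolding h_def by blast
qed

text \<open>The product \<open>gauss * gauss * gaussbar\<close> is computed in two ways, exactly
  (\<open>m = 0\<close>), and the coefficients of \<open>X\<close> are compared.\<close>

lemma jacobi_norm: "jacobi * eis_cnj jacobi = of_nat q"
proof -
  have "grpcong q 0 (gauss * gauss * gaussbar) (smult jacobi gaussbar * gaussbar)"
    by (rule ideal_cong_mult[OF gauss_square ideal_cong_refl])
  also have "smult jacobi gaussbar * gaussbar = smult jacobi (gaussbar * gaussbar)"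
    by simp
  also have "grpcong q 0 \<dots> (smult jacobi (smult (eis_cnj jacobi) gauss))"
    by (rule ideal_cong_smult[OF gaussbar_square])
  finally have "grpcong q 0 (smult (jacobi * eis_cnj jacobi) gauss) (gauss * (gauss * gaussbar))"
    by (simp add: ideal_cong_sym mult.assoc)
  also note gauss_gauss_gaussbar
  finally have "of_nat 0 dvd jacobi * eis_cnj jacobi * chi 1 - of_nat q * chi 1"
    unfolding grpring_smult using q_gt_3 by (intro grpring_cong_imp_dvd[of q]) auto
  then show ?thesis by (simp add: chi_1)
qed

text \<open>Modulo \<open>p\<close> the power moves onto each term, giving \<open>chi x ^ p\<close>
  at exponent \<open>p * x\<close>. The factor \<open>chi (int p) ^ p\<close> allows the
  substitution of \<open>p * x\<close> by a new variable.\<close>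

lemma gauss_frobenius:
  assumes "prime p" "p \<noteq> q"
  shows "grpcong q p (smult (chi (int p) ^ p) (gauss ^ p)) (grpring q (\<lambda>x. chi x ^ p))"
proof -
  let ?Z = "{0..<int q}"
  let ?F = "\<lambda>y. monom (chi y ^ p) (nat (y mod int q))"
  have "\<not> int q dvd int p"
    using assms prime_q primes_dvd_imp_eq[of q p] by auto
  have "grpcong q p (gauss ^ p) (\<Sum>x\<in>?Z. monom (chi x) (nat x) ^ p)"
    unfolding grpring_def by (intro ideal_cong_of_dvd frobenius_sum assms)
  also have "grpcong q p \<dots> (\<Sum>x\<in>?Z. monom (chi x ^ p) ((nat x * p) mod q))"
    unfolding monom_power by (intro ideal_cong_sum grpcong_monom)
  finally have "grpcong q p (smult (chi (int p) ^ p) (gauss ^ p))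
      (smult (chi (int p) ^ p) (\<Sum>x\<in>?Z. monom (chi x ^ p) ((nat x * p) mod q)))"
    by (rule ideal_cong_smult)
  also have "smult (chi (int p) ^ p) (\<Sum>x\<in>?Z. monom (chi x ^ p) ((nat x * p) mod q)) =
      (\<Sum>x\<in>?Z. ?F (int p * x + 0))"
    unfolding smult_sum_right
    by (intro sum.cong refl)
      (auto simp: smult_monom chi_mult power_mult_distrib nat_mod_distrib nat_mult_distrib mult.commute)
  also have "\<dots> = (\<Sum>x\<in>?Z. ?F x)"
  proof (rule sum_periodic_affine[OF prime_q \<open>\<not> int q dvd int p\<close>])
    show "periodic q ?F"
      using periodic_chi by (simp add: periodic_def)
  qed
  also have "\<dots> = grpring q (\<lambda>x. chi x ^ p)"
    by (simp add: grpring_def)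
  finally show ?thesis .
qed

text \<open>Modulo \<open>3\<close> the cube of \<open>gauss\<close> has
  \<open>X\<close>-coefficient \<open>chi 1 ^ 3 = 1\<close> by Frobenius, and \<open>-jacobi\<close>
  by the multiplication rules.\<close>

lemma jacobi_mod_3: "3 dvd jacobi + 1"
proof -
  have "\<not> int q dvd 3"
    using q_gt_3 zdvd_not_zless[of 3 "int q"] by auto
  then have "chi (int 3) ^ 3 = 1"
    by (intro cubic_values_cube chi_in) (simp add: chi_eq_0_iff)
  then have "grpcong q 3 (gauss ^ 3) (grpring q (\<lambda>x. chi x ^ 3))"
    using gauss_frobenius[of 3] q_gt_3 by simp
  from ideal_cong_sym[OF this]
  have "grpcong q 3 (grpring q (\<lambda>x. chi x ^ 3)) (gauss * gauss * gauss)"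
    by (simp add: power3_eq_cube)
  also have "grpcong q 3 \<dots> (smult jacobi gaussbar * gauss)"
    by (rule ideal_cong_mult[OF gauss_square ideal_cong_refl])
  also have "\<dots> = smult jacobi (gauss * gaussbar)"
    by (simp add: mult.commute)
  also have "grpcong q 3 \<dots>
      (smult jacobi (grpring q (\<lambda>t. if int q dvd t then of_nat q - 1 else - 1)))"
    by (rule ideal_cong_smult[OF gauss_gaussbar])
  finally have "of_nat 3 dvd chi 1 ^ 3 -
      jacobi * (if int q dvd 1 then of_nat q - 1 else - 1)"
    unfolding grpring_smult using q_gt_3 by (intro grpring_cong_imp_dvd[of q]) auto
  then show ?thesis
    using q_gt_3 by (simp add: chi_1 add.commute)
qed

text \<open>The step uses \<open>gauss^4 = q * jacobi * gauss\<close>. One factor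
  \<open>gauss\<close> is kept throughout, as the cube alone is not a scalar in the group
  ring.\<close>

lemma gauss_power: "grpcong q m (gauss ^ (3 * n + 1)) (smult ((of_nat q * jacobi) ^ n) gauss)"
proof (induction n)
  case (Suc n)
  have "gauss ^ (3 * Suc n + 1) = gauss ^ (3 * n + 1) * gauss ^ 3"
    unfolding power_add[symmetric] by (rule arg_cong) simp
  also have "grpcong q m \<dots> (smult ((of_nat q * jacobi) ^ n) gauss * gauss ^ 3)"
    by (rule ideal_cong_mult[OF Suc.IH ideal_cong_refl])
  also have "\<dots> = smult ((of_nat q * jacobi) ^ n) ((gauss * gauss) * (gauss * gauss))"
    by (simp add: power3_eq_cube mult.assoc)
  also have "grpcong q m \<dots>
      (smult ((of_nat q * jacobi) ^ n) (smult jacobi gaussbar * smult jacobi gaussbar))"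
    by (intro ideal_cong_smult ideal_cong_mult gauss_square)
  also have "\<dots> = smult ((of_nat q * jacobi) ^ n * jacobi * jacobi) (gaussbar * gaussbar)"
    by (simp add: mult_ac)
  also have "grpcong q m \<dots>
      (smult ((of_nat q * jacobi) ^ n * jacobi * jacobi) (smult (eis_cnj jacobi) gauss))"
    by (intro ideal_cong_smult gaussbar_square)
  also have "\<dots> = smult ((of_nat q * jacobi) ^ n * jacobi * (jacobi * eis_cnj jacobi)) gauss"
    by (simp add: mult_ac)
  also have "\<dots> = smult ((of_nat q * jacobi) ^ Suc n) gauss"
    unfolding jacobi_norm by (simp add: mult_ac)
  finally show ?case .
qed simp

lemma chi_power_mod_3: "chi x ^ (3 * n + k) = chi x ^ k" if "k > 0"
proof (cases "chi x = 0")
  case False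
  then show ?thesis
    using cubic_values_cube[OF chi_in, of x] by (simp add: power_add power_mult)
qed (use that in \<open>simp add: zero_power\<close>)

text \<open>Here \<open>chi x ^ p = chi x\<close>, so \<open>gauss_frobenius\<close> and
  \<open>gauss_power\<close> give two multiples of \<open>gauss\<close> to compare at
  \<open>X\<close>.\<close>

lemma reciprocity_1:
  assumes "prime p" "p \<noteq> q" "p = 3 * n + 1"
  shows "of_nat p dvd chi (int p) * (of_nat q * jacobi) ^ n - 1"
proof -
  have pow: "chi x ^ p = chi x" for x
    using chi_power_mod_3[of 1 x n] assms(3) by simp
  have "grpcong q p (smult (chi (int p) * (of_nat q * jacobi) ^ n) gauss)
      (smult (chi (int p)) (gauss ^ p))"
    using ideal_cong_smult[OF ideal_cong_sym[OF gauss_power], of p "chi (int p)" n] assms(3)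
    by simp
  also have "grpcong q p \<dots> gauss"
    using gauss_frobenius[OF assms(1,2)] by (simp add: pow)
  finally have "of_nat p dvd chi (int p) * (of_nat q * jacobi) ^ n * chi 1 - chi 1"
    unfolding grpring_smult using q_gt_3 by (intro grpring_cong_imp_dvd[of q]) auto
  then show ?thesis by (simp add: chi_1)
qed

text \<open>Now \<open>chi x ^ p\<close> is the conjugate and \<open>p\<close> is not of the form in
  \<open>gauss_power\<close>. Multiplying by \<open>gauss^2\<close> gives the exponent
  \<open>p + 2 = 3 * Suc n + 1\<close> and turns \<open>gaussbar\<close> into
  \<open>q * gauss\<close>.\<close>

lemma reciprocity_2:
  assumes "prime p" "p \<noteq> q" "p = 3 * n + 2"
  shows "of_nat p dvd chibar (int p) * (of_nat q * jacobi) ^ Suc n - of_nat q"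
proof -
  have pow: "chi x ^ p = chibar x" for x
    using chi_power_mod_3[of 2 x n] assms(3) cubic_values_square[OF chi_in] by simp
  have "grpcong q p (smult (chibar (int p) * (of_nat q * jacobi) ^ Suc n) gauss)
      (smult (chibar (int p)) (gauss ^ (3 * Suc n + 1)))"
    using ideal_cong_smult[OF ideal_cong_sym[OF gauss_power], of p "chibar (int p)" "Suc n"]
    by simp
  also have "smult (chibar (int p)) (gauss ^ (3 * Suc n + 1)) =
      (gauss * gauss) * smult (chibar (int p)) (gauss ^ p)"
  proof -
    have "gauss ^ (3 * Suc n + 1) = gauss ^ 2 * gauss ^ p"
      unfolding power_add[symmetric] assms(3) by (rule arg_cong) simp
    then show ?thesis by (simp add: power2_eq_square)
  qed
  also have "grpcong q p \<dots> ((gauss * gauss) * gaussbar)"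
    using ideal_cong_mult_left[OF gauss_frobenius[OF assms(1,2)], of "gauss * gauss"]
    by (simp add: pow)
  also have "(gauss * gauss) * gaussbar = gauss * (gauss * gaussbar)"
    by (simp add: mult.assoc)
  also note gauss_gauss_gaussbar
  finally have "of_nat p dvd chibar (int p) * (of_nat q * jacobi) ^ Suc n * chi 1 - of_nat q * chi 1"
    unfolding grpring_smult using q_gt_3 by (intro grpring_cong_imp_dvd[of q]) auto
  then show ?thesis by (simp add: chi_1)
qed

section \<open>Identification of the Jacobi sum\<close>

lemma sum_power_mod_q:
  assumes "m < q - 1"
  shows "int q dvd (\<Sum>x\<in>{0..<int q}. x ^ m)"
proof (cases "m = 0")
  case False
  then obtain a where a: "\<not> int q dvd a" "\<not> [a ^ m = 1] (mod int q)"
    using exists_power_not_cong_1[OF prime_q] assms by blast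
  let ?S = "\<Sum>x\<in>{0..<int q}. x ^ m"
  let ?f = "\<lambda>x. x ^ m mod int q"
  have "periodic q ?f"
    by (simp add: periodic_def power_mod)
  from sum_periodic_affine[OF prime_q a(1) this, of 0]
  have "(\<Sum>x\<in>{0..<int q}. (a * x) ^ m mod int q) mod int q =
      (\<Sum>x\<in>{0..<int q}. x ^ m mod int q) mod int q"
    by simp
  then have "[a ^ m * ?S = ?S] (mod int q)"
    by (simp add: cong_def mod_sum_eq power_mult_distrib sum_distrib_left)
  then have "int q dvd (a ^ m - 1) * ?S"
    by (simp add: cong_iff_dvd_diff left_diff_distrib)
  with a(2) show ?thesis
    using prime_int_q by (simp add: prime_dvd_mult_iff cong_iff_dvd_diff)
qed simp

text \<open>Modulo \<open>q\<close> the Jacobi sum is the sum over all residues of a polynomial of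
  degree \<open>2 * e < q - 1\<close>, and the power sums of such degrees vanish.\<close>

lemma red_jacobi: "int q dvd red jacobi"
proof -
  define e where "e = (q - 1) div 3"
  let ?Z = "{0..<int q}"
  have red_sum: "red (sum f A) = (\<Sum>x\<in>A. red (f x))" for f :: "int \<Rightarrow> eis" and A
    by (simp add: red_def ecoeff_sum sum.distrib sum_distrib_right)
  have "[red jacobi = (\<Sum>x\<in>?Z. x ^ e * (1 - x) ^ e)] (mod int q)"
    unfolding jacobi_def red_sum
  proof (rule cong_sum)
    fix x
    show "[red (chi x * chi (1 - x)) = x ^ e * (1 - x) ^ e] (mod int q)"
      using red_mult[of "chi x" "chi (1 - x)"] cong_mult[OF red_chi[of x] red_chi[of "1 - x"]]
      unfolding e_def by (rule cong_trans)
  qed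
  also have "(\<Sum>x\<in>?Z. x ^ e * (1 - x) ^ e) =
      (\<Sum>x\<in>?Z. \<Sum>j\<le>e. of_nat (e choose j) * (- 1) ^ j * x ^ (e + j))"
  proof (rule sum.cong[OF refl])
    fix x :: int
    have "(1 - x) ^ e = (\<Sum>j\<le>e. of_nat (e choose j) * (- x) ^ j * 1 ^ (e - j))"
      using binomial_ring[of "- x" 1 e] by simp
    then show "x ^ e * (1 - x) ^ e = (\<Sum>j\<le>e. of_nat (e choose j) * (- 1) ^ j * x ^ (e + j))"
      by (simp add: sum_distrib_left power_add power_minus[of x] mult_ac)
  qed
  also have "\<dots> = (\<Sum>j\<le>e. of_nat (e choose j) * (- 1) ^ j * (\<Sum>x\<in>?Z. x ^ (e + j)))"
    by (subst sum.swap) (simp add: sum_distrib_left)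
  finally have *: "[red jacobi = (\<Sum>j\<le>e. of_nat (e choose j) * (- 1) ^ j * (\<Sum>x\<in>?Z. x ^ (e + j)))]
      (mod int q)" .
  have "int q dvd (\<Sum>j\<le>e. of_nat (e choose j) * (- 1) ^ j * (\<Sum>x\<in>?Z. x ^ (e + j)))"
  proof (rule dvd_sum, rule dvd_mult, rule sum_power_mod_q)
    fix j assume "j \<in> {..e}"
    then show "e + j < q - 1"
      using exponent q_gt_3 unfolding e_def by auto
  qed
  with * show ?thesis
    using cong_dvd_iff by blast
qed

text \<open>With \<open>jacobi = (L' + 3 M' sqrt(-3)) / 2\<close>, both pairs have norm
  \<open>q\<close>, first entry \<open>1\<close> modulo \<open>3\<close> and image zero under
  \<open>red\<close> (this is \<open>s_LM\<close> for \<open>L\<close>, \<open>M\<close>). These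
  properties determine the pair.\<close>

lemma jacobi_eq:
  fixes L M :: int
  assumes norm: "4 * int q = L ^ 2 + 27 * M ^ 2" and L: "[L = 1] (mod 3)"
    and s_LM: "int q dvd 6 * M * s + 3 * M + L"
  shows "2 * ecoeff0 jacobi = L + 3 * M" "ecoeff1 jacobi = 3 * M"
proof -
  have "of_int 3 dvd jacobi + 1"
    using jacobi_mod_3 by simp
  then have "3 dvd ecoeff0 jacobi + 1" "3 dvd ecoeff1 jacobi"
    by (simp_all only: of_int_dvd_eis_iff ecoeff_simps add_0_right)
  then obtain M' where M': "ecoeff1 jacobi = 3 * M'"
    by (auto elim: dvdE)
  define L' where "L' = 2 * ecoeff0 jacobi - 3 * M'"
  have L': "[L' = 1] (mod 3)"
    using \<open>3 dvd ecoeff0 jacobi + 1\<close> unfolding L'_def cong_iff_dvd_diff by presburger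
  have "ecoeff0 (jacobi * eis_cnj jacobi) = int q"
    by (simp add: jacobi_norm)
  then have norm': "4 * int q = L' ^ 2 + 27 * M' ^ 2"
    by (simp add: M' L'_def algebra_simps power2_eq_square)
  \<comment> \<open>Eliminating \<open>s\<close> between the two vanishing residues.\<close>
  have "M * L' - M' * L = M * (2 * red jacobi) - M' * (6 * M * s + 3 * M + L)"
    by (simp add: red_def M' L'_def algebra_simps)
  then have D_dvd: "int q dvd M * L' - M' * L"
    using red_jacobi s_LM by simp
  \<comment> \<open>The product of the two norm equations as a single norm. A nonzero multiple of
    \<open>q\<close> in the last square would already contribute at least
    \<open>27 * q^2\<close>.\<close>
  have sq: "16 * int q ^ 2 = (L * L' + 27 * M * M') ^ 2 + 27 * (M * L' - M' * L) ^ 2"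
  proof -
    have "16 * int q ^ 2 = (4 * int q) * (4 * int q)"
      by (simp add: power2_eq_square)
    also have "\<dots> = (L ^ 2 + 27 * M ^ 2) * (L' ^ 2 + 27 * M' ^ 2)"
      by (simp only: norm[symmetric] norm'[symmetric])
    finally show ?thesis
      by (simp add: algebra_simps power2_eq_square)
  qed
  have D: "M * L' = M' * L"
  proof (rule ccontr)
    assume "M * L' \<noteq> M' * L"
    then have "int q \<le> \<bar>M * L' - M' * L\<bar>"
      using D_dvd by (intro zdvd_imp_le) auto
    then have "int q ^ 2 \<le> (M * L' - M' * L) ^ 2"
      using power_mono[of "int q" "\<bar>M * L' - M' * L\<bar>" 2] by simp
    moreover have "0 \<le> (L * L' + 27 * M * M') ^ 2" "0 < int q ^ 2"
      using q_gt_3 by auto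
    ultimately show False
      using sq by linarith
  qed
  define E where "E = L * L' + 27 * M * M'"
  have "(E - 4 * int q) * (E + 4 * int q) = 0"
  proof -
    have "16 * int q ^ 2 = E ^ 2"
      using sq D by (simp add: E_def)
    then show ?thesis
      by (simp add: algebra_simps power2_eq_square)
  qed
  then have E: "E = 4 * int q \<or> E = - (4 * int q)"
    by auto
  have "E * L' = L * L' ^ 2 + 27 * M' * (M * L')"
    by (simp add: E_def algebra_simps power2_eq_square)
  also have "\<dots> = L * (4 * int q)"
    unfolding D norm' by (simp add: algebra_simps power2_eq_square)
  finally have EL: "E * L' = L * (4 * int q)" .
  have "E * M' = (M' * L) * L' + 27 * M * M' ^ 2"
    by (simp add: E_def algebra_simps power2_eq_square)
  also have "\<dots> = M * (4 * int q)"
    unfolding D[symmetric] norm' by (simp add: algebra_simps power2_eq_square)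
  finally have EM: "E * M' = M * (4 * int q)" .
  \<comment> \<open>The residues of \<open>L\<close> and \<open>L'\<close> modulo \<open>3\<close>
    exclude the opposite sign.\<close>
  have "E \<noteq> - (4 * int q)"
  proof
    assume "E = - (4 * int q)"
    with EL have "(L' + L) * int q = 0"
      by (simp add: algebra_simps)
    then have "L' = - L"
      using q_gt_3 by auto
    with L L' show False
      unfolding cong_iff_dvd_diff by presburger
  qed
  with E have "E = 4 * int q"
    by simp
  with EL EM have "L' = L" "M' = M"
    using q_gt_3 by simp_all
  then show "2 * ecoeff0 jacobi = L + 3 * M" "ecoeff1 jacobi = 3 * M"
    using M' by (simp_all add: L'_def)
qed

section \<open>The Lucas quotient modulo \<open>p\<close>\<close>

lemma of_nat_prime_dvd_eis_cancel:
  assumes "prime p" "p \<noteq> q" "of_nat p dvd of_nat q * (x :: eis)"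
  shows "of_nat p dvd x"
proof -
  have p: "prime (int p)" "\<not> int p dvd int q"
    using assms(1,2) prime_q primes_dvd_imp_eq[of p q] by auto
  have "of_int (int p) dvd of_nat q * x"
    using assms(3) by simp
  then have "of_int (int p) dvd x"
    using p by (simp only: of_int_dvd_eis_iff) (simp add: prime_dvd_mult_iff)
  then show ?thesis by simp
qed

lemma lucas_odd_jacobi_cong:
  fixes L M :: int
  assumes norm: "4 * int q = L ^ 2 + 27 * M ^ 2" and "[L = 1] (mod 3)"
    and "int q dvd 6 * M * s + 3 * M + L"
    and p: "prime p" "p \<noteq> 2" "p \<noteq> 3" "p \<noteq> q"
  defines "n \<equiv> p div 3"
  shows "of_nat p dvd (jacobi - eis_cnj jacobi) * of_int (lucas_odd (- (L ^ 2)) (int q) n) -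
    of_nat q ^ n * (chi (int p) * jacobi - chibar (int p) * eis_cnj jacobi)"
proof -
  define u where "u = jacobi"
  define v where "v = eis_cnj jacobi"
  define c where "c = chi (int p)"
  define d where "d = eis_cnj c"
  note J = jacobi_eq[OF assms(1-3)]
  have uv: "u * v = of_nat q"
    by (simp add: u_def v_def jacobi_norm)
  have "u + v = of_int L"
    unfolding u_def v_def using J by (intro eis_eqI) simp_all
  then have lucas: "(u - v) * of_int (lucas_odd (- (L ^ 2)) (int q) n) =
      (- 1) ^ n * (u ^ (2 * n + 1) - v ^ (2 * n + 1))"
    using lucas_binet(1)[of u v n] uv by (simp add: lucas_odd_def)
  have cc: "c * c = d"
    unfolding c_def d_def using cubic_values_square[OF chi_in] by (simp add: power2_eq_square)
  have dd: "d * d = c"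
    using arg_cong[OF cc, of eis_cnj] by (simp add: d_def)
  define X where "X = u ^ n"
  define Y where "Y = v ^ n"
  have XY: "of_nat q ^ n = X * Y"
    by (simp add: X_def Y_def uv flip: power_mult_distrib)
  have pow_odd: "u ^ (2 * n + 1) = u * (X * X)" "v ^ (2 * n + 1) = v * (Y * Y)"
    by (simp_all add: X_def Y_def power_add mult_2)
  have "odd p"
    using p(1,2) prime_odd_nat[of p] prime_ge_2_nat[of p] by force
  have "\<not> 3 dvd p"
    using p primes_dvd_imp_eq[of 3 p] by auto
  then have "p = 3 * n + 1 \<or> p = 3 * n + 2"
    unfolding n_def by presburger
  then have "of_nat p dvd (u - v) * of_int (lucas_odd (- (L ^ 2)) (int q) n) -
      of_nat q ^ n * (c * u - d * v)"
  proof
    assume 1: "p = 3 * n + 1"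
    with \<open>odd p\<close> have "even n"
      by simp
    have cX: "of_nat p dvd c * (X * Y * X) - 1"
      using reciprocity_1[OF p(1,4) 1] unfolding c_def u_def[symmetric]
      by (simp add: power_mult_distrib XY X_def[symmetric])
    \<comment> \<open>Conjugation exchanges \<open>u\<close> with \<open>v\<close>, \<open>X\<close>
      with \<open>Y\<close> and \<open>c\<close> with \<open>d\<close>.\<close>
    have dY: "of_nat p dvd d * (X * Y * Y) - 1"
      using eis_cnj_mono_dvd[OF cX] by (simp add: d_def X_def Y_def u_def v_def mult_ac)
    let ?E = "c * (X * Y * X) - 1" and ?F = "d * (X * Y * Y) - 1"
    \<comment> \<open>Comparing \<open>cX\<close> and \<open>dY\<close> gives
      \<open>c * X = d * Y\<close> and hence \<open>X = c * Y\<close> modulo \<open>p\<close>, so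
      \<open>X * X\<close> may be replaced by \<open>c * X * Y\<close> and \<open>Y * Y\<close> by
      \<open>d * X * Y\<close>. The cofactors record this without inverting anything.\<close>
    have "u * (X * X) - v * (Y * Y) - X * Y * (c * u - d * v) =
        ?E * (u * c * X * Y + v * Y * Y) - ?F * (u * X * X + v * d * X * Y)
        - (c * c - d) * (u * X * X * X * Y * Y) + (d * d - c) * (v * X * X * Y * Y * Y)"
      by (simp add: algebra_simps)
    also have "\<dots> = ?E * (u * c * X * Y + v * Y * Y) - ?F * (u * X * X + v * d * X * Y)"
      by (simp add: cc dd)
    finally have "of_nat p dvd u * (X * X) - v * (Y * Y) - X * Y * (c * u - d * v)"
      using cX dY by simp
    then show ?thesis
      using \<open>even n\<close> unfolding lucas XY pow_odd by simp
  next
    assume 2: "p = 3 * n + 2"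
    with \<open>odd p\<close> have "odd n"
      by simp
    have "of_nat p dvd d * (of_nat q * u) ^ Suc n - of_nat q"
      using reciprocity_2[OF p(1,4) 2] by (simp only: c_def d_def u_def)
    also have "d * (of_nat q * u) ^ Suc n - of_nat q = of_nat q * (d * (X * Y * X) * u - 1)"
      by (simp add: power_mult_distrib XY algebra_simps flip: X_def)
    finally have dX: "of_nat p dvd d * (X * Y * X) * u - 1"
      by (rule of_nat_prime_dvd_eis_cancel[OF p(1,4)])
    have cY: "of_nat p dvd c * (X * Y * Y) * v - 1"
      using eis_cnj_mono_dvd[OF dX] by (simp add: d_def X_def Y_def u_def v_def mult_ac)
    let ?E = "d * (X * Y * X) * u - 1" and ?F = "c * (X * Y * Y) * v - 1"
    \<comment> \<open>Here the comparison gives \<open>u * X = d * v * Y\<close> modulo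
      \<open>p\<close>, so \<open>u\<close> and \<open>v\<close> change places; the sign from odd
      \<open>n\<close> restores the formula of the other case.\<close>
    have "- (u * (X * X) - v * (Y * Y)) - X * Y * (c * u - d * v) =
        ?F * (c * u * X * Y + u * X * X) - ?E * (v * Y * Y + d * v * X * Y)
        - (c * c - d) * (u * v * X * X * Y * Y * Y) + (d * d - c) * (u * v * X * X * X * Y * Y)"
      by (simp add: algebra_simps)
    also have "\<dots> = ?F * (c * u * X * Y + u * X * X) - ?E * (v * Y * Y + d * v * X * Y)"
      by (simp add: cc dd)
    finally have "of_nat p dvd - (u * (X * X) - v * (Y * Y)) - X * Y * (c * u - d * v)"
      using dX cY by simp
    then show ?thesis
      using \<open>odd n\<close> unfolding lucas XY pow_odd by simp
  qed
  then show ?thesis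
    by (simp add: u_def v_def c_def d_def)
qed

text \<open>Coefficients of \<open>eis_omega\<close> are compared: that of
  \<open>jacobi - eis_cnj jacobi\<close> is \<open>6 * M\<close>, and the three right-hand factors
  come from multiplying \<open>jacobi\<close> by each cube root of unity.\<close>

lemma lucas_odd_cong:
  fixes L M :: int
  assumes norm: "4 * int q = L ^ 2 + 27 * M ^ 2" and "[L = 1] (mod 3)"
    and "int q dvd 6 * M * s + 3 * M + L"
    and p: "prime p" "p \<noteq> 2" "p \<noteq> 3" "p \<noteq> q"
  defines "n \<equiv> p div 3"
  shows "chi (int p) = 1 \<Longrightarrow>
      int p dvd lucas_odd (- (L ^ 2)) (int q) n * (6 * M) - int q ^ n * (6 * M)"
    and "chi (int p) = eis_omega \<Longrightarrow>
      int p dvd lucas_odd (- (L ^ 2)) (int q) n * (6 * M) - int q ^ n * (L - 3 * M)"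
    and "chi (int p) = eis_cnj eis_omega \<Longrightarrow>
      int p dvd lucas_odd (- (L ^ 2)) (int q) n * (6 * M) - int q ^ n * (- L - 3 * M)"
proof -
  note J = jacobi_eq[OF assms(1-3)]
  have "of_int (int p) dvd (jacobi - eis_cnj jacobi) * of_int (lucas_odd (- (L ^ 2)) (int q) n) -
    of_int (int q ^ n) * (chi (int p) * jacobi - chibar (int p) * eis_cnj jacobi)"
    using lucas_odd_jacobi_cong[OF assms(1-7)] by (simp add: n_def)
  then have *: "int p dvd ecoeff1 ((jacobi - eis_cnj jacobi) * of_int (lucas_odd (- (L ^ 2)) (int q) n) -
    of_int (int q ^ n) * (chi (int p) * jacobi - chibar (int p) * eis_cnj jacobi))"
    by (simp only: of_int_dvd_eis_iff)
  show "int p dvd lucas_odd (- (L ^ 2)) (int q) n * (6 * M) - int q ^ n * (6 * M)"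
    if "chi (int p) = 1"
  proof -
    have "ecoeff1 ((jacobi - eis_cnj jacobi) * of_int (lucas_odd (- (L ^ 2)) (int q) n) -
      of_int (int q ^ n) * (chi (int p) * jacobi - chibar (int p) * eis_cnj jacobi)) =
      lucas_odd (- (L ^ 2)) (int q) n * (6 * M) - int q ^ n * (6 * M)"
      unfolding that ecoeff_simps ecoeff_of_int using J by (simp add: algebra_simps)
    with * show ?thesis by simp
  qed
  show "int p dvd lucas_odd (- (L ^ 2)) (int q) n * (6 * M) - int q ^ n * (L - 3 * M)"
    if "chi (int p) = eis_omega"
  proof -
    have "ecoeff1 ((jacobi - eis_cnj jacobi) * of_int (lucas_odd (- (L ^ 2)) (int q) n) -
      of_int (int q ^ n) * (chi (int p) * jacobi - chibar (int p) * eis_cnj jacobi)) =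
      lucas_odd (- (L ^ 2)) (int q) n * (6 * M) - int q ^ n * (2 * ecoeff0 jacobi - 6 * M)"
      unfolding that ecoeff_simps ecoeff_of_int using J(2) by (simp add: algebra_simps)
    with * show ?thesis by (simp add: J(1))
  qed
  show "int p dvd lucas_odd (- (L ^ 2)) (int q) n * (6 * M) - int q ^ n * (- L - 3 * M)"
    if "chi (int p) = eis_cnj eis_omega"
  proof -
    have "ecoeff1 ((jacobi - eis_cnj jacobi) * of_int (lucas_odd (- (L ^ 2)) (int q) n) -
      of_int (int q ^ n) * (chi (int p) * jacobi - chibar (int p) * eis_cnj jacobi)) =
      lucas_odd (- (L ^ 2)) (int q) n * (6 * M) - int q ^ n * (- (2 * ecoeff0 jacobi))"
      unfolding that ecoeff_simps ecoeff_of_int using J(2) by (simp add: algebra_simps)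
    with * show ?thesis by (simp add: J(1))
  qed
qed

end

section \<open>The binomial sum\<close>

lemma choose_3k_mult: "int ((3 * k) choose k) * fact (2 * k) * fact k = fact (3 * k)"
proof -
  have "int (fact k * fact (3 * k - k) * ((3 * k) choose k)) = int (fact (3 * k))"
    by (subst binomial_fact_lemma) simp_all
  moreover have "3 * k - k = 2 * k"
    by simp
  ultimately show ?thesis
    by (simp only: of_nat_mult of_nat_fact mult_ac)
qed

text \<open>With the factor \<open>fact (2 * k)\<close> the binomials obey a first-order recurrence
  over the integers, to be matched with that of \<open>choose_n_plus_k_Suc\<close>.\<close>

lemma choose_3k_Suc:
  "int ((3 * Suc k) choose Suc k) * fact (2 * Suc k) =
     int ((3 * k) choose k) * fact (2 * k) * (3 * (3 * int k + 1) * (3 * int k + 2))"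
proof -
  have "fact k * int (Suc k) * (int ((3 * Suc k) choose Suc k) * fact (2 * Suc k)) =
      fact (3 * Suc k)"
    using choose_3k_mult[of "Suc k"] unfolding fact_Suc[of k] by (simp only: mult_ac)
  also have "\<dots> = fact (3 * k) * ((3 * int k + 1) * (3 * int k + 2) * (3 * int k + 3))"
    by (simp add: eval_nat_numeral algebra_simps)
  also have "\<dots> = fact k * int (Suc k) *
      (int ((3 * k) choose k) * fact (2 * k) * (3 * (3 * int k + 1) * (3 * int k + 2)))"
    unfolding choose_3k_mult[symmetric] by (simp add: algebra_simps)
  finally show ?thesis
    by (simp del: of_nat_Suc)
qed

lemma choose_n_plus_k_Suc:
  assumes "k < n"
  shows "int ((n + Suc k) choose (2 * Suc k)) * fact (2 * Suc k) =
    int ((n + k) choose (2 * k)) * fact (2 * k) * ((int n + int k + 1) * (int n - int k))"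
proof -
  have fact: "fact (2 * j) * fact (n - j) * int ((n + j) choose (2 * j)) = fact (n + j)"
    if "j \<le> n" for j
  proof -
    have "int (fact (2 * j) * fact (n + j - 2 * j) * ((n + j) choose (2 * j))) = int (fact (n + j))"
      using that by (subst binomial_fact_lemma) simp_all
    moreover have "n + j - 2 * j = n - j"
      by simp
    ultimately show ?thesis
      by (simp only: of_nat_mult of_nat_fact)
  qed
  have "n - k = Suc (n - Suc k)" "int n - int k = int (n - Suc k) + 1"
    using assms by auto
  then have fn: "fact (n - k) = (int n - int k) * fact (n - Suc k)"
    by (simp add: algebra_simps)
  have "fact (n - Suc k) * (int ((n + Suc k) choose (2 * Suc k)) * fact (2 * Suc k)) =
      fact (n + Suc k)"
    using fact[of "Suc k"] assms by (simp add: mult_ac)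
  also have "\<dots> = (int n + int k + 1) * fact (n + k)"
    by (simp add: algebra_simps)
  also have "\<dots> = fact (n - Suc k) *
      (int ((n + k) choose (2 * k)) * fact (2 * k) * ((int n + int k + 1) * (int n - int k)))"
    using fact[of k] assms by (simp add: fn algebra_simps)
  finally show ?thesis by simp
qed

text \<open>As \<open>p\<close> is \<open>3 * n + 1\<close> or \<open>3 * n + 2\<close>, it divides
  their product, which makes the two recurrence factors agree modulo \<open>p\<close> up to
  \<open>-27\<close>. The factorial cancels because \<open>2 * k < p\<close>.\<close>

lemma choose_3k_cong:
  assumes "prime p" "p \<noteq> 3" "k \<le> p div 3"
  shows "[int ((3 * k) choose k) = (- 27) ^ k * int ((p div 3 + k) choose (2 * k))] (mod int p)"
proof -
  define n where "n = p div 3"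
  have "\<not> 3 dvd p"
    using assms(1,2) primes_dvd_imp_eq[of 3 p] by auto
  then have "p = 3 * n + 1 \<or> p = 3 * n + 2"
    unfolding n_def by presburger
  then have "int p = 3 * int n + 1 \<or> int p = 3 * int n + 2"
    by linarith
  then have p_dvd: "int p dvd (3 * int n + 1) * (3 * int n + 2)"
    by fastforce
  have "[int ((3 * k) choose k) * fact (2 * k) =
      (- 27) ^ k * (int ((n + k) choose (2 * k)) * fact (2 * k))] (mod int p)"
    if "k \<le> n"
    using that
  proof (induction k)
    case (Suc k)
    have "3 * (3 * int k + 1) * (3 * int k + 2) - (- 27) * ((int n + int k + 1) * (int n - int k)) =
        3 * ((3 * int n + 1) * (3 * int n + 2))"
      by (simp add: algebra_simps)
    then have *: "[3 * (3 * int k + 1) * (3 * int k + 2) =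
        (- 27) * ((int n + int k + 1) * (int n - int k))] (mod int p)"
      using p_dvd by (simp only: cong_iff_dvd_diff dvd_mult)
    have "(- 27) ^ Suc k * (int ((n + Suc k) choose (2 * Suc k)) * fact (2 * Suc k)) =
        (- 27) ^ k * (int ((n + k) choose (2 * k)) * fact (2 * k)) *
        ((- 27) * ((int n + int k + 1) * (int n - int k)))"
      unfolding choose_n_plus_k_Suc[OF Suc_le_lessD[OF Suc.prems]] power_Suc
      by (simp only: mult_ac)
    moreover have "k \<le> n"
      using Suc.prems by simp
    ultimately show ?case
      using cong_mult[OF Suc.IH *] by (simp only: choose_3k_Suc)
  qed simp
  moreover have "coprime (fact (2 * k)) (int p)"
  proof -
    have "\<not> p dvd fact (2 * k)"
      using assms n_def by (simp add: prime_dvd_fact_iff) (use prime_ge_2_nat[of p] in linarith)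
    then have "coprime (fact (2 * k)) p"
      using assms(1) by (metis coprime_commute prime_imp_coprime)
    then show ?thesis
      by (metis coprime_int_iff of_nat_fact)
  qed
  ultimately show ?thesis
    using assms(3) unfolding n_def[symmetric]
    by (metis (no_types, lifting) cong_mult_rcancel mult.assoc)
qed

text \<open>The sum is scaled by \<open>(27 * q)^n\<close> to make it integral; the subtracted
  \<open>q^n\<close> is the missing term \<open>k = 0\<close>.\<close>

lemma sum_choose_3k_cong:
  fixes L :: int
  assumes "prime p" "p \<noteq> 3"
  defines "n \<equiv> p div 3"
  shows "[(\<Sum>k = 1..n. int ((3 * k) choose k) * (L ^ 2) ^ k * (27 * int q) ^ (n - k)) =
    27 ^ n * (lucas_odd (- (L ^ 2)) (int q) n - int q ^ n)] (mod int p)"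
proof -
  have "[(\<Sum>k = 1..n. int ((3 * k) choose k) * (L ^ 2) ^ k * (27 * int q) ^ (n - k)) =
     (\<Sum>k = 1..n. ((- 27) ^ k * int ((n + k) choose (2 * k))) * (L ^ 2) ^ k * (27 * int q) ^ (n - k))]
     (mod int p)"
    using choose_3k_cong[OF assms(1,2)] unfolding n_def
    by (intro cong_sum cong_mult cong_refl) auto
  also have "(\<Sum>k = 1..n. ((- 27) ^ k * int ((n + k) choose (2 * k))) * (L ^ 2) ^ k * (27 * int q) ^ (n - k)) =
     (\<Sum>k = 1..n. 27 ^ n * (int ((n + k) choose (2 * k)) * (- (L ^ 2)) ^ k * int q ^ (n - k)))"
  proof (rule sum.cong[OF refl])
    fix k assume "k \<in> {1..n}"
    then have "(27 :: int) ^ n = 27 ^ k * 27 ^ (n - k)"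
      by (simp flip: power_add)
    then show "((- 27) ^ k * int ((n + k) choose (2 * k))) * (L ^ 2) ^ k * (27 * int q) ^ (n - k) =
        27 ^ n * (int ((n + k) choose (2 * k)) * (- (L ^ 2)) ^ k * int q ^ (n - k))"
      by (simp add: power_mult_distrib power_minus[of "27 :: int"] power_minus[of "L ^ 2"] mult_ac)
  qed
  also have "\<dots> = 27 ^ n * (lucas_odd (- (L ^ 2)) (int q) n - int q ^ n)"
  proof -
    have "{..n} = insert 0 {1..n}"
      by auto
    then show ?thesis
      by (simp add: lucas_odd_def sum_distrib_left)
  qed
  finally show ?thesis .
qed

section \<open>From congruences of fractions to divisibility of integers\<close>

lemma of_int_divide_in_integral_at:
  assumes "\<not> int l dvd d"
  shows "of_int m / of_int d \<in> integral_at l"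
proof -
  obtain a b where ab: "quotient_of (of_int m / of_int d) = (a, b)"
    by fastforce
  then have "b > 0" "coprime a b" and eq: "of_int m / of_int d = (of_int a / of_int b :: rat)"
    by (auto simp: quotient_of_denom_pos quotient_of_coprime quotient_of_div)
  have "d \<noteq> 0"
    using assms by auto
  with eq \<open>b > 0\<close> have "of_int (m * b) = (of_int (a * d) :: rat)"
    by (simp add: field_simps)
  then have "m * b = a * d"
    by (simp only: of_int_eq_iff)
  then have "b dvd d"
    using \<open>coprime a b\<close> by (metis coprime_commute coprime_dvd_mult_right_iff dvd_triv_right)
  then show ?thesis
    using assms ab by (auto simp: integral_at_def)
qed

lemma rat_cong_divide_iff:
  assumes "prime l" "\<not> int l dvd d" "\<not> int l dvd d'"
  shows "rat_cong (of_int m / of_int d) (of_int m' / of_int d') l \<longleftrightarrow> int l dvd m * d' - m' * d"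
proof -
  have nz: "(of_int d :: rat) \<noteq> 0" "(of_int d' :: rat) \<noteq> 0"
    using assms by auto
  have l: "prime (int l)"
    using assms(1) by simp
  have diff: "of_int m / of_int d - of_int m' / of_int d' =
      (of_int (m * d' - m' * d) / of_int (d * d') :: rat)"
    using nz by (simp add: field_simps)
  show ?thesis
  proof
    assume "rat_cong (of_int m / of_int d) (of_int m' / of_int d') l"
    then obtain z where z: "z \<in> integral_at l"
      "of_int m / of_int d - of_int m' / of_int d' = of_nat l * z"
      by (auto simp: rat_cong_def)
    obtain a b where ab: "quotient_of z = (a, b)"
      by fastforce
    then have "b > 0" "z = of_int a / of_int b" "\<not> int l dvd b"
      using z(1) by (auto simp: quotient_of_denom_pos quotient_of_div integral_at_def)
    then have "(of_int ((m * d' - m' * d) * b) :: rat) = of_int (int l * (a * (d * d')))"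
      using z(2) nz unfolding diff by (simp add: field_simps)
    then have "(m * d' - m' * d) * b = int l * (a * (d * d'))"
      by (simp only: of_int_eq_iff)
    then have "int l dvd (m * d' - m' * d) * b"
      by simp
    then show "int l dvd m * d' - m' * d"
      using l \<open>\<not> int l dvd b\<close> by (simp add: prime_dvd_mult_iff)
  next
    assume "int l dvd m * d' - m' * d"
    then obtain t where "m * d' - m' * d = int l * t" ..
    then have "of_int m / of_int d - of_int m' / of_int d' =
        (of_nat l * (of_int t / of_int (d * d')) :: rat)"
      unfolding diff by simp
    moreover have "\<not> int l dvd d * d'"
      using l assms by (simp add: prime_dvd_mult_iff)
    ultimately show "rat_cong (of_int m / of_int d) (of_int m' / of_int d') l"
      unfolding rat_cong_def using assms of_int_divide_in_integral_at by blast
  qed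
qed

text \<open>Only \<open>N\<close> varies between the three cases of the theorem; the
  \<open>- 6 * M\<close> in the numerator accounts for the missing term
  \<open>k = 0\<close>.\<close>

lemma sum_choose_3k_rat_cong:
  fixes L M N :: int
  assumes "prime p" "p \<noteq> 2" "p \<noteq> 3" "prime q" "p \<noteq> q" "\<not> int p dvd M"
  defines "n \<equiv> p div 3"
  assumes dvd: "int p dvd lucas_odd (- (L ^ 2)) (int q) n * (6 * M) - int q ^ n * N"
  shows "rat_cong (\<Sum>k = 1..n. of_nat ((3 * k) choose k) * (of_int L ^ 2 / (27 * of_nat q)) ^ k)
    (of_int (N - 6 * M) / of_int (6 * M)) p"
proof -
  define a where "a = lucas_odd (- (L ^ 2)) (int q) n"
  define T where "T = (\<Sum>k = 1..n. int ((3 * k) choose k) * (L ^ 2) ^ k * (27 * int q) ^ (n - k))"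
  have q0: "q > 0"
    using assms prime_gt_0_nat by blast
  have p: "prime (int p)"
    using assms(1) by simp
  have not_dvd: "\<not> int p dvd 2" "\<not> int p dvd 3" "\<not> int p dvd int q"
    using assms primes_dvd_imp_eq[of p 2] primes_dvd_imp_eq[of p 3] primes_dvd_imp_eq[of p q]
    by (auto simp flip: int_dvd_int_iff)
  have "(27 :: int) = 3 ^ 3" "(6 :: int) = 2 * 3"
    by simp_all
  with not_dvd p have not_dvd': "\<not> int p dvd 27" "\<not> int p dvd 6"
    by (metis prime_dvd_power, metis prime_dvd_mult_iff)
  have T: "(\<Sum>k = 1..n. of_nat ((3 * k) choose k) * (of_int L ^ 2 / (27 * of_nat q)) ^ k) =
      (of_int T / of_int ((27 * int q) ^ n) :: rat)"
    unfolding T_def of_int_sum sum_divide_distrib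
  proof (rule sum.cong[OF refl])
    fix k assume "k \<in> {1..n}"
    then have "(27 * of_nat q :: rat) ^ n = (27 * of_nat q) ^ k * (27 * of_nat q) ^ (n - k)"
      unfolding power_add[symmetric] by simp
    then show "of_nat ((3 * k) choose k) * (of_int L ^ 2 / (27 * of_nat q)) ^ k =
        (of_int (int ((3 * k) choose k) * (L ^ 2) ^ k * (27 * int q) ^ (n - k)) /
         of_int ((27 * int q) ^ n) :: rat)"
      using q0 by (simp add: power_divide)
  qed
  have "[T * (6 * M) - (N - 6 * M) * (27 * int q) ^ n =
      27 ^ n * (a - int q ^ n) * (6 * M) - (N - 6 * M) * (27 * int q) ^ n] (mod int p)"
    using sum_choose_3k_cong[OF assms(1,3), where L = L and q = q]
    unfolding T_def a_def n_def by (intro cong_diff cong_mult cong_refl)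
  also have "27 ^ n * (a - int q ^ n) * (6 * M) - (N - 6 * M) * (27 * int q) ^ n =
      27 ^ n * (a * (6 * M) - int q ^ n * N)"
    by (simp add: power_mult_distrib algebra_simps)
  finally have "int p dvd T * (6 * M) - (N - 6 * M) * (27 * int q) ^ n"
    using dvd unfolding a_def[symmetric] by (simp add: cong_dvd_iff)
  moreover have "\<not> int p dvd 27 * int q" "\<not> int p dvd 6 * M"
    using p not_dvd not_dvd' assms(6) prime_dvd_mult_iff by blast+
  moreover from this(1) have "\<not> int p dvd (27 * int q) ^ n"
    using p prime_dvd_power by blast
  ultimately show ?thesis
    unfolding T using assms(1) by (subst rat_cong_divide_iff) auto
qed

theorem theorem2p8:
  fixes p q :: nat and L M :: int
  defines "r \<equiv> (of_int L / (3 * of_int M) :: rat)"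
  defines "S \<equiv> (\<Sum>k = 1..p div 3.
                  of_nat ((3 * k) choose k) * (of_int L ^ 2 / (27 * of_nat q)) ^ k :: rat)"
  assumes "prime q" and "[q = 1] (mod 3)"
    and "4 * int q = L ^ 2 + 27 * M ^ 2" and "[L = 1] (mod 3)"
    and "prime p" and "p \<noteq> 2" and "p \<noteq> 3" and "p \<noteq> q" and "\<not> int p dvd M"
  shows "([p ^ ((q - 1) div 3) = 1] (mod q) \<longrightarrow> rat_cong S 0 p) \<and>
         (rat_cong (of_nat (p ^ ((q - 1) div 3))) ((- 1 - r) / 2) q \<longrightarrow>
            rat_cong S ((- 3 + r) / 2) p) \<and>
         (rat_cong (of_nat (p ^ ((q - 1) div 3))) ((- 1 + r) / 2) q \<longrightarrow>
            rat_cong S ((- 3 - r) / 2) p)"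
proof -
  have q: "prime (int q)" "q > 3"
  proof -
    have "q \<noteq> 2" "q \<noteq> 3"
      using assms(4) by (auto simp: cong_def)
    then show "q > 3"
      using assms(3) prime_ge_2_nat[of q] by linarith
  qed (use assms(3) in simp)
  have M0: "M \<noteq> 0"
    using assms(11) by auto
  \<comment> \<open>Otherwise \<open>M^2\<close> is at least \<open>q^2\<close>, whereas
    \<open>27 * M^2\<close> is at most \<open>4 * q\<close>.\<close>
  have "\<not> int q dvd M"
  proof
    assume M: "int q dvd M"
    have "int q * int q dvd M * M"
      using M by (intro mult_dvd_mono)
    then have "int q * int q \<le> M * M"
      using M0 by (intro zdvd_imp_le) (auto simp: zero_less_mult_iff)
    moreover have "4 * int q < 27 * (int q * int q)"
      using q(2) by simp
    moreover have "27 * (M * M) \<le> 4 * int q"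
      using assms(5) by (simp add: power2_eq_square)
    ultimately show False by linarith
  qed
  moreover have "\<not> int q dvd 6"
  proof
    assume "int q dvd 6"
    then have "int q dvd 2 * 3" by simp
    then have "int q dvd 2 \<or> int q dvd 3"
      using q(1) prime_dvd_mult_iff by blast
    then show False
      using q(2) zdvd_imp_le[of "int q" 2] zdvd_imp_le[of "int q" 3] by auto
  qed
  ultimately have q6M: "\<not> int q dvd 6 * M"
    using q(1) prime_dvd_mult_iff by blast
  then have "coprime (6 * M) (int q)"
    using q(1) by (metis coprime_commute prime_imp_coprime)
  then obtain t where t: "[6 * M * t = 1] (mod int q)"
    using cong_solve_coprime_int by blast
  \<comment> \<open>Modulo \<open>q\<close> this is \<open>(-1 - r) / 2\<close>, the residue of
    \<open>eis_omega\<close> for which \<open>(L + 3 M sqrt(-3)) / 2\<close> vanishes. The second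
    and third hypotheses on \<open>p\<close> thus name \<open>s\<close> and
    \<open>-1 - s\<close>.\<close>
  define s where "s = t * (- 3 * M - L)"
  have "6 * M * s + 3 * M + L = (6 * M * t - 1) * (- 3 * M - L)"
    by (simp add: s_def algebra_simps)
  then have s_LM: "int q dvd 6 * M * s + 3 * M + L"
    using t by (simp add: cong_iff_dvd_diff)
  \<comment> \<open>Completing the square; the last summand is \<open>4 * q\<close>.\<close>
  have "(6 * M) * ((6 * M) * (s ^ 2 + s + 1)) =
      (6 * M * s + 3 * M + L) * (6 * M * s + 3 * M - L) + (L ^ 2 + 27 * M ^ 2)"
    by (simp add: algebra_simps power2_eq_square)
  then have "int q dvd (6 * M) * ((6 * M) * (s ^ 2 + s + 1))"
    using s_LM by (simp flip: assms(5))
  then have s2: "int q dvd s ^ 2 + s + 1"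
    using q(1) q6M prime_dvd_mult_iff by blast
  interpret cubic_residue q s
    using assms(3,4) s2 by unfold_locales
  define P where "P = int p ^ ((q - 1) div 3)"
  note chi_p = chi_eqI[of _ "int p", folded P_def]
  note lucas = lucas_odd_cong[OF assms(5,6) s_LM assms(7-10)]
  note S_cong = sum_choose_3k_rat_cong[OF assms(7-9,3,10,11), of L, folded S_def]
  have P_cong: "int q dvd P * (6 * M) - N"
    if "rat_cong (of_nat (p ^ ((q - 1) div 3))) (of_int N / of_int (6 * M)) q" for N
    using that rat_cong_divide_iff[OF assms(3) _ q6M, of 1 P N] q(2) by (simp add: P_def)
  have cancel: "int q dvd x" if "int q dvd 6 * M * x" for x
    using that q(1) q6M prime_dvd_mult_iff by blast
  show ?thesis
  proof (intro conjI impI)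
    assume "[p ^ ((q - 1) div 3) = 1] (mod q)"
    then have "[P = 1] (mod int q)"
      unfolding P_def by (metis cong_int_iff of_nat_1 of_nat_power)
    then have "chi (int p) = 1"
      by (intro chi_p) (simp_all add: cubic_values_def red_def cong_sym_eq)
    from S_cong[OF lucas(1)[OF this]] show "rat_cong S 0 p"
      by simp
  next
    assume "rat_cong (of_nat (p ^ ((q - 1) div 3))) ((- 1 - r) / 2) q"
    also have "(- 1 - r) / 2 = of_int (- 3 * M - L) / of_int (6 * M)"
      using M0 by (simp add: r_def field_simps)
    finally have "int q dvd P * (6 * M) - (- 3 * M - L)"
      by (rule P_cong)
    then have "int q dvd 6 * M * (s - P)"
      using dvd_diff[OF s_LM, of "P * (6 * M) - (- 3 * M - L)"] by (simp add: algebra_simps)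
    then have "[s = P] (mod int q)"
      unfolding cong_iff_dvd_diff by (rule cancel)
    then have "chi (int p) = eis_omega"
      by (intro chi_p) (simp_all add: cubic_values_def red_def)
    moreover have "(- 3 + r) / 2 = of_int (L - 3 * M - 6 * M) / of_int (6 * M)"
      using M0 by (simp add: r_def field_simps)
    ultimately show "rat_cong S ((- 3 + r) / 2) p"
      using S_cong[OF lucas(2)] by metis
  next
    assume "rat_cong (of_nat (p ^ ((q - 1) div 3))) ((- 1 + r) / 2) q"
    also have "(- 1 + r) / 2 = of_int (- 3 * M + L) / of_int (6 * M)"
      using M0 by (simp add: r_def field_simps)
    finally have "int q dvd P * (6 * M) - (- 3 * M + L)"
      by (rule P_cong)
    then have "int q dvd 6 * M * (P - (- 1 - s))"
      using dvd_add[OF s_LM, of "P * (6 * M) - (- 3 * M + L)"] by (simp add: algebra_simps)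
    then have "[P = - 1 - s] (mod int q)"
      unfolding cong_iff_dvd_diff by (rule cancel)
    then have "chi (int p) = eis_cnj eis_omega"
      by (intro chi_p) (simp_all add: cubic_values_def red_def cong_sym_eq)
    moreover have "(- 3 - r) / 2 = of_int (- L - 3 * M - 6 * M) / of_int (6 * M)"
      using M0 by (simp add: r_def field_simps)
    ultimately show "rat_cong S ((- 3 - r) / 2) p"
      using S_cong[OF lucas(3)] by metis
  qed
qed

end
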